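(* Let $\mathcal{H}$ be an irreducible complete Pick reproducing kernel Hilbert space of analytic functions on $\mathbb{D}$ with kernel $k$. Suppose $\frac{1}{k(0,0)}-\frac{1}{k(z,w)}=q(z\bar w)$ for a function $q$ analytic in $R\mathbb{D}$ for some $R>1$, with $q'(0)\neq0$. If $\mathcal{H}$ does not extend to a larger disc, then $\mathcal{H}=H^2(\mathbb{D})$ with equivalent norms.
   Context: $\mathbb{D}$ is the open unit disc and $H^2(\mathbb{D})$ the Hardy space. An RKHS is irreducible if its kernel never vanishes. It is complete Pick if for every $m\ge1$, points $\lambda_1,\dots,\lambda_n$ and matrices $A_1,\dots,A_n\in M_m(\mathbb{C})$, positivity of $[(1-A_jA_k^* )k(\lambda_j,\lambda_k)]_{j,k}$ implies existence of an $m\times m$ multiplier $F$ of norm $\le1$ with $F(\lambda_j)=A_j$. "$\mathcal{H}$ does not extend to a larger disc" means there is no $R'>1$ such that the kernel $k$ extends to $R'\mathbb{D}\times R'\mathbb{D}$, analytic in the first variable and anti-analytic in the second. *)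

theory Defs
  imports "HOL-Complex_Analysis.Complex_Analysis"
begin

text \<open>Functions on the disc are represented as functions complex => complex
  that vanish outside the open unit disc (convention).\<close>

definition disc :: "complex set" where "disc = ball 0 1"

definition kfun :: "(complex \<Rightarrow> complex \<Rightarrow> complex) \<Rightarrow> complex \<Rightarrow> complex \<Rightarrow> complex" where
  "kfun k w = (\<lambda>z. if z \<in> disc then k z w else 0)"

definition hnorm :: "((complex \<Rightarrow> complex) \<Rightarrow> (complex \<Rightarrow> complex) \<Rightarrow> complex) \<Rightarrow> (complex \<Rightarrow> complex) \<Rightarrow> real" where
  "hnorm ip f = sqrt (Re (ip f f))"

definition is_rkhs_disc ::
  "(complex \<Rightarrow> complex) set \<Rightarrow> ((complex \<Rightarrow> complex) \<Rightarrow> (complex \<Rightarrow> complex) \<Rightarrow> complex)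
   \<Rightarrow> (complex \<Rightarrow> complex \<Rightarrow> complex) \<Rightarrow> bool" where
  "is_rkhs_disc H ip k \<longleftrightarrow>
     (\<forall>f\<in>H. \<forall>z. z \<notin> disc \<longrightarrow> f z = 0) \<and>
     (\<lambda>z. 0) \<in> H \<and>
     (\<forall>f\<in>H. \<forall>g\<in>H. (\<lambda>z. f z + g z) \<in> H) \<and>
     (\<forall>c. \<forall>f\<in>H. (\<lambda>z. c * f z) \<in> H) \<and>
     (\<forall>f\<in>H. \<forall>g\<in>H. \<forall>h\<in>H. ip (\<lambda>z. f z + g z) h = ip f h + ip g h) \<and>
     (\<forall>c. \<forall>f\<in>H. \<forall>g\<in>H. ip (\<lambda>z. c * f z) g = c * ip f g) \<and>
     (\<forall>f\<in>H. \<forall>g\<in>H. ip g f = cnj (ip f g)) \<and>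
     (\<forall>f\<in>H. 0 \<le> Re (ip f f)) \<and>
     (\<forall>f\<in>H. ip f f = 0 \<longrightarrow> f = (\<lambda>z. 0)) \<and>
     (\<forall>F::nat \<Rightarrow> complex \<Rightarrow> complex. (\<forall>n. F n \<in> H) \<and>
        (\<forall>e>0. \<exists>N. \<forall>m\<ge>N. \<forall>n\<ge>N. hnorm ip (\<lambda>z. F m z - F n z) < e) \<longrightarrow>
        (\<exists>f\<in>H. (\<lambda>n. hnorm ip (\<lambda>z. F n z - f z)) \<longlonglongrightarrow> 0)) \<and>
     (\<forall>w\<in>disc. kfun k w \<in> H \<and> (\<forall>f\<in>H. f w = ip f (kfun k w)))"

definition psd_on :: "'i set \<Rightarrow> ('i \<Rightarrow> 'i \<Rightarrow> complex) \<Rightarrow> bool" where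
  "psd_on I M \<longleftrightarrow> (\<forall>c::'i \<Rightarrow> complex.
     Im (\<Sum>i\<in>I. \<Sum>j\<in>I. cnj (c i) * M i j * c j) = 0 \<and>
     0 \<le> Re (\<Sum>i\<in>I. \<Sum>j\<in>I. cnj (c i) * M i j * c j))"

text \<open>An m x m matrix valued function F (entries F z a b, a b < m) is a multiplier of
  H tensor C^m of multiplier norm at most 1.\<close>
definition contractive_multiplier ::
  "(complex \<Rightarrow> complex) set \<Rightarrow> ((complex \<Rightarrow> complex) \<Rightarrow> (complex \<Rightarrow> complex) \<Rightarrow> complex)
   \<Rightarrow> nat \<Rightarrow> (complex \<Rightarrow> nat \<Rightarrow> nat \<Rightarrow> complex) \<Rightarrow> bool" where
  "contractive_multiplier H ip m F \<longleftrightarrow>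
     (\<forall>f::nat \<Rightarrow> complex \<Rightarrow> complex. (\<forall>i<m. f i \<in> H) \<longrightarrow>
        (\<forall>a<m. (\<lambda>z. \<Sum>b<m. F z a b * f b z) \<in> H) \<and>
        (\<Sum>a<m. (hnorm ip (\<lambda>z. \<Sum>b<m. F z a b * f b z))\<^sup>2) \<le> (\<Sum>a<m. (hnorm ip (f a))\<^sup>2))"

definition pick_matrix ::
  "(complex \<Rightarrow> complex \<Rightarrow> complex) \<Rightarrow> nat \<Rightarrow> (nat \<Rightarrow> complex) \<Rightarrow> (nat \<Rightarrow> nat \<Rightarrow> nat \<Rightarrow> complex)
   \<Rightarrow> nat \<times> nat \<Rightarrow> nat \<times> nat \<Rightarrow> complex" where
  "pick_matrix k m lam A = (\<lambda>(j, a) (l, b).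
     ((if a = b then 1 else 0) - (\<Sum>c<m. A j a c * cnj (A l b c))) * k (lam j) (lam l))"

definition complete_pick ::
  "(complex \<Rightarrow> complex) set \<Rightarrow> ((complex \<Rightarrow> complex) \<Rightarrow> (complex \<Rightarrow> complex) \<Rightarrow> complex)
   \<Rightarrow> (complex \<Rightarrow> complex \<Rightarrow> complex) \<Rightarrow> bool" where
  "complete_pick H ip k \<longleftrightarrow>
     (\<forall>m::nat \<ge> 1. \<forall>n::nat. \<forall>lam::nat \<Rightarrow> complex. \<forall>A::nat \<Rightarrow> nat \<Rightarrow> nat \<Rightarrow> complex.
        (\<forall>j<n. lam j \<in> disc) \<longrightarrow>
        psd_on ({..<n} \<times> {..<m}) (pick_matrix k m lam A) \<longrightarrow>
        (\<exists>F. contractive_multiplier H ip m F \<and>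
             (\<forall>j<n. \<forall>a<m. \<forall>b<m. F (lam j) a b = A j a b)))"

definition irreducible_kernel :: "(complex \<Rightarrow> complex \<Rightarrow> complex) \<Rightarrow> bool" where
  "irreducible_kernel k \<longleftrightarrow> (\<forall>z\<in>disc. \<forall>w\<in>disc. k z w \<noteq> 0)"

definition extends_to_larger_disc :: "(complex \<Rightarrow> complex \<Rightarrow> complex) \<Rightarrow> bool" where
  "extends_to_larger_disc k \<longleftrightarrow> (\<exists>R'>1. \<exists>K::complex \<Rightarrow> complex \<Rightarrow> complex.
     (\<forall>z\<in>disc. \<forall>w\<in>disc. K z w = k z w) \<and>
     (\<forall>w\<in>ball 0 R'. (\<lambda>z. K z w) holomorphic_on ball 0 R') \<and>
     (\<forall>z\<in>ball 0 R'. (\<lambda>w. cnj (K z w)) holomorphic_on ball 0 R'))"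

definition taylor0 :: "(complex \<Rightarrow> complex) \<Rightarrow> nat \<Rightarrow> complex" where
  "taylor0 f n = (deriv ^^ n) f 0 / fact n"

definition hardy2 :: "(complex \<Rightarrow> complex) set" where
  "hardy2 = {f. f holomorphic_on disc \<and> (\<forall>z. z \<notin> disc \<longrightarrow> f z = 0) \<and>
                summable (\<lambda>n. (cmod (taylor0 f n))\<^sup>2)}"

definition hardy2_norm :: "(complex \<Rightarrow> complex) \<Rightarrow> real" where
  "hardy2_norm f = sqrt (\<Sum>n. (cmod (taylor0 f n))\<^sup>2)"

end

theory Submission
  imports Defs
begin

text \<open>By necessity in the McCullough--Quiggin theorem the matrices with entries
  \<open>k(0,0) q(\<lambda>\<^sub>i cnj \<lambda>\<^sub>j)\<close> are positive semidefinite, which forces the Taylor coefficients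
  \<open>c\<^sub>n\<close> of \<open>u = k(0,0) q\<close> to be nonnegative. As \<open>k\<close> is finite on the disc, \<open>u(1) \<le> 1\<close>, and
  \<open>u(1) < 1\<close> would give an extension of \<open>k = k(0,0) / (1 - u)\<close>; hence \<open>\<Sum>c\<^sub>n = 1\<close>. The
  coefficients \<open>b\<^sub>n\<close> of \<open>1 / (1 - u)\<close> are then a renewal sequence whose increments \<open>c\<^sub>n\<close>
  decay geometrically and have \<open>c\<^sub>1 > 0\<close>, so they lie between positive constants. Finally the
  norm of the space is the one with weights \<open>1 / (k(0,0) b\<^sub>n)\<close> on the Taylor coefficients.\<close>

section \<open>Positive semidefinite matrices\<close>

text \<open>Nonnegativity of the c_n is used twice. It gives |u(t)| <= u(|t|), so a single rho > 1
  with u(rho) < 1 keeps 1 - u free of zeros on the whole disc of radius rho, and this is what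
  produces the extension. It also makes the renewal sequence nonnegative and bounded by 1. The
  hypothesis R > 1 supplies both the room for such a rho and the geometric decay of the tails of c.
  The hypothesis on q'(0) excludes periodicity: for u(t) = t^2 the kernel is the power series in (z
  cnj w)^2 with coefficients 1, every odd b_n is 0, and the space is a proper subspace of the Hardy
  space. For equivalent norms two-sided bounds on b_n suffice, so a bound over windows of fixed
  length replaces the limit in the renewal theorem.\<close>

lemma psd_on_hermitian:
  assumes psd: "psd_on I M" and fin: "finite I" and ij: "i \<in> I" "j \<in> I"
  shows "M i j = cnj (M j i)" "Im (M i i) = 0" "0 \<le> Re (M i i)"
    and "i \<noteq> j \<Longrightarrow> Re (M i i) = 0 \<Longrightarrow> M i j = 0"
proof -
  define Q where "Q c = (\<Sum>i\<in>I. \<Sum>j\<in>I. cnj (c i) * M i j * c j)" for c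
  have Q: "Im (Q c) = 0" "0 \<le> Re (Q c)" for c
    using psd unfolding psd_on_def Q_def by blast+
  have Q1: "Q (\<lambda>l. if l = i then 1 else 0) = M i i" if "i \<in> I" for i
    using fin that by (simp add: Q_def if_distrib [of cnj] if_distrib[of "\<lambda>x. x * _"]
        if_distrib[of "\<lambda>x. _ * x"] sum.If_cases cong: if_cong)
  have d: "Im (M i i) = 0" "0 \<le> Re (M i i)" if "i \<in> I" for i
    using Q[of "\<lambda>l. if l = i then 1 else 0"] Q1[OF that] by simp_all
  show "Im (M i i) = 0" "0 \<le> Re (M i i)" using d ij by blast+
  have Q2: "Q (\<lambda>l. if l = i then x else if l = j then y else 0)
      = cnj x * M i i * x + cnj x * M i j * y + cnj y * M j i * x + cnj y * M j j * y"
    (is "Q ?c = _") if "i \<noteq> j" for x y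
  proof -
    have S: "(\<Sum>l\<in>I. f l) = f i + f j" if "\<And>l. l \<notin> {i,j} \<Longrightarrow> f l = 0" for f :: "_ \<Rightarrow> complex"
    proof -
      have "(\<Sum>l\<in>I. f l) = (\<Sum>l\<in>{i,j}. f l)"
        by (rule sum.mono_neutral_right) (use fin ij that in auto)
      then show ?thesis using \<open>i \<noteq> j\<close> by simp
    qed
    have "Q ?c = (\<Sum>k\<in>I. cnj (?c k) * M k i * ?c i + cnj (?c k) * M k j * ?c j)"
      unfolding Q_def by (intro sum.cong refl S) auto
    also have "\<dots> = (cnj (?c i) * M i i * ?c i + cnj (?c i) * M i j * ?c j)
        + (cnj (?c j) * M j i * ?c i + cnj (?c j) * M j j * ?c j)"
      by (rule S) auto
    finally show ?thesis using that by (auto simp: algebra_simps)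
  qed
  show h: "M i j = cnj (M j i)"
  proof (cases "i = j")
    case True
    then show ?thesis using d[OF ij(1)] by (simp add: complex_eq_iff)
  next
    case False
    \<comment> \<open>Polarisation: the entries 1, 1 show that \<open>M i j + M j i\<close> is real,
      the entries 1, \<open>\<i>\<close> that \<open>M i j - M j i\<close> is purely
      imaginary.\<close>
    have "Im (M i j + M j i) = 0"
      using Q(1)[of "\<lambda>l. if l = i then 1 else if l = j then 1 else 0"] Q2[OF False, of 1 1] d ij
      by simp
    moreover have "Im (\<i> * M i j - \<i> * M j i) = 0"
      using Q(1)[of "\<lambda>l. if l = i then 1 else if l = j then \<i> else 0"] Q2[OF False, of 1 \<i>] d ij
      by simp
    ultimately show ?thesis by (simp add: complex_eq_iff)
  qed
  assume ne: "i \<noteq> j" and z: "Re (M i i) = 0"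
  have Mi: "M i i = 0" using z d[OF ij(1)] by (simp add: complex_eq_iff)
  have mji: "M j i = cnj (M i j)" using h by simp
  \<comment> \<open>As \<open>M i i = 0\<close>, the form at the vector with entries
    \<open>-t * M i j\<close> and 1 has no quadratic term in \<open>t\<close>. Being affine in
    \<open>t\<close> and nonnegative, it must be constant.\<close>
  have key: "0 \<le> Re (M j j) - 2 * t * (cmod (M i j))\<^sup>2" for t :: real
  proof -
    have "cnj (of_real (-t) * M i j) * M i j + M j i * (of_real (-t) * M i j)
       = of_real (- 2 * t * (cmod (M i j))\<^sup>2)"
      unfolding mji by (simp add: algebra_simps flip: complex_norm_square)
    then have "Q (\<lambda>l. if l = i then of_real (-t) * M i j else if l = j then 1 else 0)
        = of_real (- 2 * t * (cmod (M i j))\<^sup>2) + M j j"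
      using Q2[OF ne, of "of_real (-t) * M i j" 1] by (simp only: Mi) simp
    then show ?thesis
      using Q(2)[of "\<lambda>l. if l = i then of_real (-t) * M i j else if l = j then 1 else 0"]
      by (simp only: plus_complex.sel Re_complex_of_real)
  qed
  show "M i j = 0"
  proof (rule ccontr)
    assume "M i j \<noteq> 0"
    then have "(Re (M j j) + 1) / (cmod (M i j))\<^sup>2 * (cmod (M i j))\<^sup>2 = Re (M j j) + 1" by simp
    then show False using key[of "(Re (M j j) + 1) / (cmod (M i j))\<^sup>2"] d[OF ij(2)] by linarith
  qed
qed

text \<open>Cholesky factorisation by induction on the size: split off the last index and pass to
  the Schur complement \<open>M'\<close>. If the pivot \<open>\<alpha>\<close> is 0, the last row
  and column vanish; since division by 0 yields 0, the same formulas cover that case.\<close>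

lemma psd_on_Gram:
  assumes "psd_on {..<n} M"
  shows "\<exists>b :: nat \<Rightarrow> nat \<Rightarrow> complex. \<forall>i<n. \<forall>j<n. M i j = (\<Sum>c<n. b i c * cnj (b j c))"
  using assms
proof (induction n arbitrary: M)
  case 0
  show ?case by simp
next
  case (Suc n)
  define \<alpha> where "\<alpha> = Re (M n n)"
  have nn: "M n n = of_real \<alpha>" and \<alpha>: "\<alpha> \<ge> 0"
    using psd_on_hermitian(2,3)[OF Suc.prems, of n] by (auto simp: \<alpha>_def complex_eq_iff)
  have herm: "M i n = cnj (M n i)" if "i < n" for i
    using psd_on_hermitian(1)[OF Suc.prems, of i n] that by simp
  have zero: "M n i = 0" if "\<alpha> = 0" "i < n" for i
    using psd_on_hermitian(4)[OF Suc.prems, of n i] that by (simp add: \<alpha>_def)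
  define M' where "M' i j = M i j - M i n * M n j / of_real \<alpha>" for i j
  have "psd_on {..<n} M'"
    unfolding psd_on_def
  proof
    fix c :: "nat \<Rightarrow> complex"
    define s where "s = (\<Sum>j<n. M n j * c j)"
    \<comment> \<open>The last coordinate that minimises the form for given \<open>c\<close>; with
      it the form of \<open>M\<close> turns into that of \<open>M'\<close>.\<close>
    define y where "y = - s / of_real \<alpha>"
    define c' where "c' = c(n := y)"
    have cs: "cnj s = (\<Sum>i<n. cnj (c i) * M i n)"
      by (simp add: s_def herm mult.commute)
    have s0: "s = 0" if "\<alpha> = 0" using zero that by (simp add: s_def)
    have "(\<Sum>i<Suc n. \<Sum>j<Suc n. cnj (c' i) * M i j * c' j)
       = (\<Sum>i<n. \<Sum>j<n. cnj (c i) * M i j * c j) + (\<Sum>i<n. cnj (c i) * M i n) * y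
          + cnj y * s + cnj y * of_real \<alpha> * y"
      by (simp add: c'_def sum.distrib sum_distrib_right sum_distrib_left s_def nn algebra_simps)
    also have "\<dots> = (\<Sum>i<n. \<Sum>j<n. cnj (c i) * M i j * c j) - cnj s * s / of_real \<alpha>"
      using s0 by (cases "\<alpha> = 0") (simp_all add: y_def field_simps flip: cs)
    also have "cnj s * s / of_real \<alpha> = (\<Sum>i<n. \<Sum>j<n. cnj (c i) * (M i n * M n j / of_real \<alpha>) * c j)"
      unfolding cs unfolding s_def sum_product sum_divide_distrib
      by (intro sum.cong refl) (simp add: algebra_simps)
    also have "(\<Sum>i<n. \<Sum>j<n. cnj (c i) * M i j * c j) - \<dots> = (\<Sum>i<n. \<Sum>j<n. cnj (c i) * M' i j * c j)"
      by (simp add: M'_def algebra_simps flip: sum_subtractf)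
    finally show "Im (\<Sum>i<n. \<Sum>j<n. cnj (c i) * M' i j * c j) = 0 \<and>
        0 \<le> Re (\<Sum>i<n. \<Sum>j<n. cnj (c i) * M' i j * c j)"
      using spec[OF Suc.prems[unfolded psd_on_def], of c'] by (simp only:)
  qed
  from Suc.IH[OF this] obtain b where
    b: "\<And>i j. i < n \<Longrightarrow> j < n \<Longrightarrow> M' i j = (\<Sum>c<n. b i c * cnj (b j c))" by blast
  define b' where "b' i c = (if c = n then if i = n then of_real (sqrt \<alpha>) else M i n / of_real (sqrt \<alpha>)
      else if i = n then 0 else b i c)" for i c
  have sq: "complex_of_real (sqrt \<alpha>) * of_real (sqrt \<alpha>) = of_real \<alpha>"
    using \<alpha> by (simp flip: of_real_mult)
  show ?case
  proof (intro exI[of _ b'] allI impI)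
    fix i j assume "i < Suc n" "j < Suc n"
    then consider "i < n" "j < n" | "i < n" "j = n" | "i = n" "j < n" | "i = n" "j = n" by linarith
    then show "M i j = (\<Sum>c<Suc n. b' i c * cnj (b' j c))"
    proof cases
      case 1
      have "(\<Sum>c<Suc n. b' i c * cnj (b' j c)) = M' i j + M i n * cnj (M j n) / of_real \<alpha>"
        using 1 b[OF 1] sq by (simp add: b'_def)
      then show ?thesis using 1 herm[of j] by (simp add: M'_def)
    next
      case 2
      then show ?thesis using zero[of i] herm[of i] sq \<alpha>
        by (cases "\<alpha> = 0") (simp_all add: b'_def)
    next
      case 3
      then show ?thesis using zero[of j] herm[of j] sq \<alpha>
        by (cases "\<alpha> = 0") (simp_all add: b'_def)
    next
      case 4
      then show ?thesis using sq nn by (simp add: b'_def)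
    qed
  qed
qed

lemma psd_on_cong:
  assumes "psd_on I M" "\<And>i j. i \<in> I \<Longrightarrow> j \<in> I \<Longrightarrow> M' i j = M i j"
  shows "psd_on I M'"
proof -
  have "(\<Sum>i\<in>I. \<Sum>j\<in>I. cnj (c i) * M' i j * c j) = (\<Sum>i\<in>I. \<Sum>j\<in>I. cnj (c i) * M i j * c j)" for c
    using assms(2) by (intro sum.cong refl) simp
  then show ?thesis using assms(1) by (simp add: psd_on_def)
qed

lemma psd_on_congruence:
  assumes "psd_on I M"
  shows "psd_on I (\<lambda>i j. x i * M i j * cnj (x j))"
  unfolding psd_on_def
proof
  fix c
  have "(\<Sum>i\<in>I. \<Sum>j\<in>I. cnj (c i) * (x i * M i j * cnj (x j)) * c j)
      = (\<Sum>i\<in>I. \<Sum>j\<in>I. cnj (cnj (x i) * c i) * M i j * (cnj (x j) * c j))"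
    by (intro sum.cong refl) (simp add: algebra_simps)
  then show "Im (\<Sum>i\<in>I. \<Sum>j\<in>I. cnj (c i) * (x i * M i j * cnj (x j)) * c j) = 0 \<and>
      0 \<le> Re (\<Sum>i\<in>I. \<Sum>j\<in>I. cnj (c i) * (x i * M i j * cnj (x j)) * c j)"
    using spec[OF assms[unfolded psd_on_def], of "\<lambda>i. cnj (x i) * c i"] by (simp only:)
qed

lemma psd_on_rank_one: "psd_on I (\<lambda>i j. x i * cnj (x j))"
  unfolding psd_on_def
proof
  fix c
  define s where "s = (\<Sum>i\<in>I. cnj (x i) * c i)"
  have "(\<Sum>i\<in>I. \<Sum>j\<in>I. cnj (c i) * (x i * cnj (x j)) * c j) = cnj s * s"
    unfolding s_def cnj_sum sum_product by (intro sum.cong refl) (simp add: mult_ac)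
  also have "\<dots> = of_real ((cmod s)\<^sup>2)"
    by (simp add: complex_norm_square mult.commute flip: of_real_power)
  finally show "Im (\<Sum>i\<in>I. \<Sum>j\<in>I. cnj (c i) * (x i * cnj (x j)) * c j) = 0 \<and>
      0 \<le> Re (\<Sum>i\<in>I. \<Sum>j\<in>I. cnj (c i) * (x i * cnj (x j)) * c j)" by simp
qed

lemma psd_on_block_diagonal:
  assumes psd: "\<And>a. a \<in> J \<Longrightarrow> psd_on I (E a)" and fin: "finite J"
  shows "psd_on (I \<times> J) (\<lambda>(i, a) (j, b). if a = b then E a i j else 0)"
  unfolding psd_on_def
proof
  fix c :: "'b \<times> 'a \<Rightarrow> complex"
  let ?M = "\<lambda>(i, a) (j, b). if a = b then E a i j else 0"
  have "(\<Sum>p\<in>I\<times>J. \<Sum>r\<in>I\<times>J. cnj (c p) * ?M p r * c r)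
      = (\<Sum>i\<in>I. \<Sum>a\<in>J. \<Sum>j\<in>I. \<Sum>b\<in>J. if a = b then cnj (c (i, a)) * E a i j * c (j, a) else 0)"
    unfolding sum.cartesian_product' by (intro sum.cong refl) auto
  also have "\<dots> = (\<Sum>i\<in>I. \<Sum>a\<in>J. \<Sum>j\<in>I. cnj (c (i, a)) * E a i j * c (j, a))"
    using fin by simp
  also have "\<dots> = (\<Sum>a\<in>J. \<Sum>i\<in>I. \<Sum>j\<in>I. cnj (c (i, a)) * E a i j * c (j, a))"
    by (rule sum.swap)
  finally have eq: "(\<Sum>p\<in>I\<times>J. \<Sum>r\<in>I\<times>J. cnj (c p) * ?M p r * c r) = \<dots>" .
  have "Im (\<Sum>i\<in>I. \<Sum>j\<in>I. cnj (c (i, a)) * E a i j * c (j, a)) = 0"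
    "0 \<le> Re (\<Sum>i\<in>I. \<Sum>j\<in>I. cnj (c (i, a)) * E a i j * c (j, a))" if "a \<in> J" for a
    using spec[OF psd[OF that, unfolded psd_on_def], of "\<lambda>i. c (i, a)"] by auto
  then show "Im (\<Sum>p\<in>I\<times>J. \<Sum>r\<in>I\<times>J. cnj (c p) * ?M p r * c r) = 0 \<and>
      0 \<le> Re (\<Sum>p\<in>I\<times>J. \<Sum>r\<in>I\<times>J. cnj (c p) * ?M p r * c r)"
    unfolding eq Im_sum[of _ J] Re_sum[of _ J] by (auto intro: sum_nonneg)
qed

section \<open>Necessity in the McCullough--Quiggin theorem\<close>

locale rkhs_disc =
  fixes H :: "(complex \<Rightarrow> complex) set"
    and ip :: "(complex \<Rightarrow> complex) \<Rightarrow> (complex \<Rightarrow> complex) \<Rightarrow> complex"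
    and k :: "complex \<Rightarrow> complex \<Rightarrow> complex"
  assumes rkhs: "is_rkhs_disc H ip k"
begin

context
  notes R0 = rkhs[unfolded is_rkhs_disc_def]
  notes R1 = R0[THEN conjunct2]
  notes R2 = R1[THEN conjunct2]
  notes R3 = R2[THEN conjunct2]
  notes R4 = R3[THEN conjunct2]
  notes R5 = R4[THEN conjunct2]
  notes R6 = R5[THEN conjunct2]
  notes R7 = R6[THEN conjunct2]
  notes R8 = R7[THEN conjunct2]
  notes R9 = R8[THEN conjunct2]
  notes R10 = R9[THEN conjunct2]
begin

lemmas H_outside = R0[THEN conjunct1, rule_format]
lemmas H_zero = R1[THEN conjunct1, rule_format]
lemmas H_add = R2[THEN conjunct1, rule_format]
lemmas H_scale = R3[THEN conjunct1, rule_format]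
lemmas ip_add_left = R4[THEN conjunct1, rule_format]
lemmas ip_scale_left = R5[THEN conjunct1, rule_format]
lemmas ip_cnj = R6[THEN conjunct1, rule_format]
lemmas ip_ge0 = R7[THEN conjunct1, rule_format]
lemmas ip_eq0 = R8[THEN conjunct1, rule_format]
lemmas H_completeness = R9[THEN conjunct1, rule_format]
lemmas kfun_in = bspec[OF R10, THEN conjunct1]
lemmas reproducing = bspec[OF R10, THEN conjunct2, rule_format, symmetric]

end

lemma H_complete:
  assumes "\<And>n. F n \<in> H"
    and "\<And>e. e > 0 \<Longrightarrow> \<exists>N. \<forall>m\<ge>N. \<forall>n\<ge>N. hnorm ip (\<lambda>z. F m z - F n z) < e"
  obtains f where "f \<in> H" "(\<lambda>n. hnorm ip (\<lambda>z. F n z - f z)) \<longlonglongrightarrow> 0"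
  using H_completeness[of F] assms by blast

lemma H_diff: "f \<in> H \<Longrightarrow> g \<in> H \<Longrightarrow> (\<lambda>z. f z - g z) \<in> H"
  using H_add[of f "\<lambda>z. -1 * g z"] H_scale[of g "-1"] by simp

lemma H_sum: "(\<And>i. i \<in> A \<Longrightarrow> f i \<in> H) \<Longrightarrow> (\<lambda>z. \<Sum>i\<in>A. f i z) \<in> H"
proof (induction A rule: infinite_finite_induct)
  case (insert x A)
  then show ?case using H_add[of "f x" "\<lambda>z. \<Sum>i\<in>A. f i z"] by simp
qed (simp_all add: H_zero)

lemma ip_diff_left: "f \<in> H \<Longrightarrow> g \<in> H \<Longrightarrow> h \<in> H \<Longrightarrow> ip (\<lambda>z. f z - g z) h = ip f h - ip g h"
  using ip_add_left[of f "\<lambda>z. -1 * g z" h] H_scale[of g "-1"] ip_scale_left[of g h "-1"] by simp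

lemma ip_scale_right: "f \<in> H \<Longrightarrow> g \<in> H \<Longrightarrow> ip f (\<lambda>z. c * g z) = cnj c * ip f g"
  using ip_cnj[OF H_scale[of g c], of f] ip_scale_left[of g f c] ip_cnj[of g f] by simp

lemma ip_add_right: "f \<in> H \<Longrightarrow> g \<in> H \<Longrightarrow> h \<in> H \<Longrightarrow> ip f (\<lambda>z. g z + h z) = ip f g + ip f h"
  using ip_cnj[OF H_add[of g h], of f] ip_add_left[of g h f] ip_cnj[of g f] ip_cnj[of h f] by simp

lemma ip_diff_right: "f \<in> H \<Longrightarrow> g \<in> H \<Longrightarrow> h \<in> H \<Longrightarrow> ip f (\<lambda>z. g z - h z) = ip f g - ip f h"
  using ip_cnj[OF H_diff[of g h], of f] ip_diff_left[of g h f] ip_cnj[of g f] ip_cnj[of h f] by simp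

lemma ip_zero_left: "f \<in> H \<Longrightarrow> ip (\<lambda>z. 0) f = 0"
  using ip_scale_left[of f f 0] by simp

lemma ip_sum_left:
  "(\<And>i. i \<in> A \<Longrightarrow> f i \<in> H) \<Longrightarrow> g \<in> H \<Longrightarrow> ip (\<lambda>z. \<Sum>i\<in>A. f i z) g = (\<Sum>i\<in>A. ip (f i) g)"
proof (induction A rule: infinite_finite_induct)
  case (insert x A)
  then show ?case using ip_add_left[of "f x" "\<lambda>z. \<Sum>i\<in>A. f i z" g] by (simp add: H_sum)
qed (simp_all add: ip_zero_left)

lemma ip_sum_right:
  "(\<And>i. i \<in> A \<Longrightarrow> f i \<in> H) \<Longrightarrow> g \<in> H \<Longrightarrow> ip g (\<lambda>z. \<Sum>i\<in>A. f i z) = (\<Sum>i\<in>A. ip g (f i))"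
proof -
  assume f: "\<And>i. i \<in> A \<Longrightarrow> f i \<in> H" and g: "g \<in> H"
  have "ip g (\<lambda>z. \<Sum>i\<in>A. f i z) = cnj (ip (\<lambda>z. \<Sum>i\<in>A. f i z) g)"
    by (rule ip_cnj[OF H_sum[OF f] g])
  also have "\<dots> = (\<Sum>i\<in>A. cnj (ip (f i) g))" by (simp add: ip_sum_left f g)
  also have "\<dots> = (\<Sum>i\<in>A. ip g (f i))" by (intro sum.cong refl ip_cnj[symmetric] f g)
  finally show ?thesis .
qed

lemma hnorm_nonneg: "f \<in> H \<Longrightarrow> 0 \<le> hnorm ip f"
  using ip_ge0 by (simp add: hnorm_def)

lemma ip_self: "f \<in> H \<Longrightarrow> ip f f = of_real ((hnorm ip f)\<^sup>2)"
  using ip_ge0[of f] ip_cnj[of f f] by (simp add: hnorm_def complex_eq_iff)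

lemma Cauchy_Schwarz:
  assumes f: "f \<in> H" and g: "g \<in> H"
  shows "cmod (ip f g) \<le> hnorm ip f * hnorm ip g"
proof (cases "hnorm ip g = 0")
  case True
  then have "g = (\<lambda>z. 0)" using ip_self[OF g] ip_eq0[OF g] by simp
  then show ?thesis using ip_zero_left[OF f] ip_cnj[OF g f] True by simp
next
  case False
  define G where "G = (hnorm ip g)\<^sup>2"
  have G: "G > 0" "ip g g = of_real G" using False ip_self[OF g] by (simp_all add: G_def)
  define c where "c = ip f g / of_real G"
  define h where "h = (\<lambda>z. f z - c * g z)"
  have cg: "(\<lambda>z. c * g z) \<in> H" using H_scale[OF g] .
  have h: "h \<in> H" unfolding h_def using H_diff[OF f cg] .
  have hg: "ip h g = 0"
    unfolding h_def using ip_diff_left[OF f cg g] ip_scale_left[OF g g, of c] G by (simp add: c_def)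
  have "ip h h = ip h f"
    using ip_diff_right[OF h f cg] ip_scale_right[OF h g, of c] hg by (simp add: h_def)
  also have "\<dots> = ip f f - c * ip g f"
    unfolding h_def using ip_diff_left[OF f cg f] ip_scale_left[OF g f, of c] by simp
  also have "\<dots> = of_real ((hnorm ip f)\<^sup>2 - (cmod (ip f g))\<^sup>2 / G)"
    using ip_cnj[OF f g] by (simp add: c_def ip_self[OF f] flip: complex_norm_square)
  finally have "0 \<le> (hnorm ip f)\<^sup>2 - (cmod (ip f g))\<^sup>2 / G"
    using ip_ge0[OF h] by (simp only: Re_complex_of_real)
  then have "(cmod (ip f g))\<^sup>2 \<le> (hnorm ip f * hnorm ip g)\<^sup>2"
    using G(1) by (simp add: field_simps G_def power_mult_distrib)
  then show ?thesis
    using hnorm_nonneg[OF f] hnorm_nonneg[OF g] by (auto intro: power2_le_imp_le)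
qed

lemma ip_tendsto:
  assumes "\<And>n. F n \<in> H" "f \<in> H" "g \<in> H" and lim: "(\<lambda>n. hnorm ip (\<lambda>z. F n z - f z)) \<longlonglongrightarrow> 0"
  shows "(\<lambda>n. ip (F n) g) \<longlonglongrightarrow> ip f g"
proof (rule LIM_zero_cancel)
  have null: "(\<lambda>n. hnorm ip (\<lambda>z. F n z - f z) * hnorm ip g) \<longlonglongrightarrow> 0"
    using tendsto_mult_right[OF lim, of "hnorm ip g"] by simp
  have "norm (ip (F n) g - ip f g) \<le> hnorm ip (\<lambda>z. F n z - f z) * hnorm ip g" for n
    using Cauchy_Schwarz[OF H_diff[OF assms(1,2)] assms(3), of n] ip_diff_left[OF assms(1,2,3), of n] by simp
  then show "(\<lambda>n. ip (F n) g - ip f g) \<longlonglongrightarrow> 0"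
    by (intro Lim_null_comparison[OF always_eventually null] allI)
qed

lemma kernel_eq_ip: "z \<in> disc \<Longrightarrow> w \<in> disc \<Longrightarrow> k z w = ip (kfun k w) (kfun k z)"
  using reproducing[of z "kfun k w"] kfun_in[of w] by (simp add: kfun_def)

lemma kernel_cnj: "z \<in> disc \<Longrightarrow> w \<in> disc \<Longrightarrow> cnj (k z w) = k w z"
  by (simp add: kernel_eq_ip ip_cnj[OF kfun_in kfun_in, of z w])

lemma kernel_diag: "z \<in> disc \<Longrightarrow> k z z = of_real ((hnorm ip (kfun k z))\<^sup>2)"
  using kernel_eq_ip ip_self kfun_in by metis

lemma psd_on_kernel:
  assumes "\<And>i. i \<in> I \<Longrightarrow> lam i \<in> disc"
  shows "psd_on I (\<lambda>i j. k (lam i) (lam j))"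
  unfolding psd_on_def
proof
  fix c
  define f where "f = (\<lambda>z. \<Sum>j\<in>I. c j * kfun k (lam j) z)"
  have t: "(\<lambda>z. c j * kfun k (lam j) z) \<in> H" if "j \<in> I" for j
    using H_scale kfun_in assms that by blast
  have f: "f \<in> H" unfolding f_def by (rule H_sum) (rule t)
  have "ip f f = (\<Sum>i\<in>I. ip f (\<lambda>z. c i * kfun k (lam i) z))"
    using ip_sum_right[of I "\<lambda>i z. c i * kfun k (lam i) z" f] t f by (simp add: f_def)
  also have "\<dots> = (\<Sum>i\<in>I. cnj (c i) * f (lam i))"
    using assms f by (intro sum.cong refl) (simp add: ip_scale_right kfun_in reproducing)
  also have "\<dots> = (\<Sum>i\<in>I. \<Sum>j\<in>I. cnj (c i) * k (lam i) (lam j) * c j)"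
    using assms by (intro sum.cong refl) (simp add: f_def kfun_def sum_distrib_left mult_ac)
  finally have "(\<Sum>i\<in>I. \<Sum>j\<in>I. cnj (c i) * k (lam i) (lam j) * c j) = of_real ((hnorm ip f)\<^sup>2)"
    using ip_self[OF f] by simp
  then show "Im (\<Sum>i\<in>I. \<Sum>j\<in>I. cnj (c i) * k (lam i) (lam j) * c j) = 0 \<and>
      0 \<le> Re (\<Sum>i\<in>I. \<Sum>j\<in>I. cnj (c i) * k (lam i) (lam j) * c j)"
    by simp
qed

text \<open>A multiplier maps the functions vanishing at z0 into themselves; the kernel of that
  subspace is the Schur complement of k at z0.\<close>

lemma psd_on_compression:
  fixes b :: "nat \<Rightarrow> nat \<Rightarrow> complex"
  assumes F: "contractive_multiplier H ip m F" and m: "m > 0"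
    and lam: "\<And>j. j < N \<Longrightarrow> lam j \<in> disc" and z0: "z0 \<in> disc" and k0: "k z0 z0 \<noteq> 0"
    and b: "\<And>j c. j < N \<Longrightarrow> c < m \<Longrightarrow> F (lam j) 0 c = b j c"
  shows "psd_on {..<N} (\<lambda>i j. (1 - (\<Sum>c<m. b i c * cnj (b j c)))
           * (k (lam i) (lam j) - k (lam i) z0 * k z0 (lam j) / k z0 z0))"
  unfolding psd_on_def
proof
  fix v :: "nat \<Rightarrow> complex"
  define r where "r w = k z0 w / k z0 z0" for w
  define \<kappa> where "\<kappa> w z = kfun k w z - r w * kfun k z0 z" for w z
  have \<kappa>H: "\<kappa> w \<in> H" if "w \<in> disc" for w
    unfolding \<kappa>_def using H_diff[OF kfun_in[OF that] H_scale[OF kfun_in[OF z0]]] .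
  have \<kappa>0: "\<kappa> w z0 = 0" for w using z0 k0 by (simp add: \<kappa>_def r_def kfun_def)
  have \<kappa>ip: "ip f (\<kappa> w) = f w" if "f \<in> H" "f z0 = 0" "w \<in> disc" for f w
    unfolding \<kappa>_def
    using ip_diff_right[OF that(1) kfun_in[OF that(3)] H_scale[OF kfun_in[OF z0]]]
      ip_scale_right[OF that(1) kfun_in[OF z0]] that z0 by (simp add: reproducing)
  define L where "L x z = (\<Sum>j<N. x j * \<kappa> (lam j) z)" for x z
  have LH: "L x \<in> H" for x
    unfolding L_def by (rule H_sum) (auto intro: H_scale \<kappa>H lam)
  have L0: "L x z0 = 0" for x by (simp add: L_def \<kappa>0)
  have Lip: "ip f (L x) = (\<Sum>j<N. cnj (x j) * f (lam j))" if "f \<in> H" "f z0 = 0" for f x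
  proof -
    have "ip f (L x) = (\<Sum>j<N. ip f (\<lambda>z. x j * \<kappa> (lam j) z))"
      unfolding L_def using ip_sum_right[of "{..<N}" "\<lambda>j z. x j * \<kappa> (lam j) z" f] that
      by (auto intro: H_scale \<kappa>H lam)
    also have "\<dots> = (\<Sum>j<N. cnj (x j) * f (lam j))"
      using that by (intro sum.cong refl) (simp add: ip_scale_right \<kappa>H lam \<kappa>ip)
    finally show ?thesis .
  qed
  have LL: "ip (L x) (L x) = (\<Sum>i<N. \<Sum>j<N. cnj (x i) * \<kappa> (lam j) (lam i) * x j)" for x
    by (simp add: Lip LH L0) (simp add: L_def sum_distrib_left mult_ac)
  \<comment> \<open>The adjoint of the row multiplier sends \<open>\<kappa> (lam j)\<close> to the
    tuple of the functions \<open>cnj (b j c)\<close> times \<open>\<kappa> (lam j)\<close>. So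
    \<open>h\<close> is the adjoint applied to \<open>L v\<close>, written out without adjoint
    operators.\<close>
  define h where "h c = L (\<lambda>j. v j * cnj (b j c))" for c
  define S where "S = (\<Sum>c<m. (hnorm ip (h c))\<^sup>2)"
  define \<phi> where "\<phi> = (\<lambda>z. \<Sum>c<m. F z 0 c * h c z)"
  have hH: "h c \<in> H" for c by (simp add: h_def LH)
  have FH: "(\<forall>a<m. (\<lambda>z. \<Sum>b<m. F z a b * h b z) \<in> H) \<and>
      (\<Sum>a<m. (hnorm ip (\<lambda>z. \<Sum>b<m. F z a b * h b z))\<^sup>2) \<le> (\<Sum>a<m. (hnorm ip (h a))\<^sup>2)"
    using F hH unfolding contractive_multiplier_def by blast
  have \<phi>: "\<phi> \<in> H" using FH m by (simp add: \<phi>_def)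
  have "(hnorm ip \<phi>)\<^sup>2 \<le> (\<Sum>a<m. (hnorm ip (\<lambda>z. \<Sum>b<m. F z a b * h b z))\<^sup>2)"
    unfolding \<phi>_def using m
    by (intro member_le_sum[where f = "\<lambda>a. (hnorm ip (\<lambda>z. \<Sum>b<m. F z a b * h b z))\<^sup>2"]) auto
  then have \<phi>S: "(hnorm ip \<phi>)\<^sup>2 \<le> S" using FH by (simp add: S_def)
  have \<phi>0: "\<phi> z0 = 0" by (simp add: \<phi>_def h_def L0)
  have "of_real S = (\<Sum>c<m. ip (h c) (h c))" by (simp add: S_def ip_self hH)
  also have "\<dots> = (\<Sum>c<m. \<Sum>j<N. cnj (v j) * b j c * h c (lam j))"
  proof (rule sum.cong[OF refl])
    fix c
    have "ip (h c) (h c) = (\<Sum>j<N. cnj (v j * cnj (b j c)) * h c (lam j))"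
      using Lip[of "h c" "\<lambda>j. v j * cnj (b j c)"] hH[of c] L0 by (simp add: h_def)
    then show "ip (h c) (h c) = (\<Sum>j<N. cnj (v j) * b j c * h c (lam j))" by simp
  qed
  also have "\<dots> = (\<Sum>j<N. \<Sum>c<m. cnj (v j) * b j c * h c (lam j))"
    by (rule sum.swap)
  also have "\<dots> = (\<Sum>j<N. cnj (v j) * \<phi> (lam j))"
    by (intro sum.cong refl) (simp add: \<phi>_def sum_distrib_left b mult.assoc)
  also have "\<dots> = ip \<phi> (L v)" using Lip[OF \<phi> \<phi>0, of v] by simp
  finally have Sip: "of_real S = ip \<phi> (L v)" .
  have S0: "S \<ge> 0" by (simp add: S_def sum_nonneg)
  \<comment> \<open>With X the row operator, \<open>S\<close> is the squared norm of X^* L v, and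
    \<open>\<phi>\<close> is X X^* L v, with squared norm at most \<open>S\<close>. As
    \<open>S = ip \<phi> (L v)\<close>, Cauchy-Schwarz bounds \<open>S\<close> squared by
    \<open>S\<close> times the squared norm of \<open>L v\<close>.\<close>
  have SG: "S \<le> (hnorm ip (L v))\<^sup>2"
  proof (cases "S = 0")
    case False
    have "S = cmod (ip \<phi> (L v))" using S0 by (simp flip: Sip)
    also have "\<dots> \<le> hnorm ip \<phi> * hnorm ip (L v)" by (rule Cauchy_Schwarz[OF \<phi> LH])
    finally have "S\<^sup>2 \<le> (hnorm ip \<phi>)\<^sup>2 * (hnorm ip (L v))\<^sup>2"
      using S0 by (metis power_mono power_mult_distrib)
    also have "\<dots> \<le> S * (hnorm ip (L v))\<^sup>2" using \<phi>S by (simp add: mult_right_mono)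
    finally show ?thesis using S0 False by (simp add: power2_eq_square)
  qed simp
  let ?Q = "\<Sum>i<N. \<Sum>j<N. cnj (v i) * ((1 - (\<Sum>c<m. b i c * cnj (b j c)))
           * (k (lam i) (lam j) - k (lam i) z0 * k z0 (lam j) / k z0 z0)) * v j"
  have "(\<Sum>c<m. ip (h c) (h c)) = (\<Sum>c<m. \<Sum>i<N. \<Sum>j<N. cnj (v i) * (b i c * cnj (b j c)) * \<kappa> (lam j) (lam i) * v j)"
    by (simp add: h_def LL mult_ac)
  also have "\<dots> = (\<Sum>i<N. \<Sum>c<m. \<Sum>j<N. cnj (v i) * (b i c * cnj (b j c)) * \<kappa> (lam j) (lam i) * v j)"
    by (rule sum.swap)
  also have "\<dots> = (\<Sum>i<N. \<Sum>j<N. \<Sum>c<m. cnj (v i) * (b i c * cnj (b j c)) * \<kappa> (lam j) (lam i) * v j)"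
    by (intro sum.cong refl sum.swap)
  also have "\<dots> = (\<Sum>i<N. \<Sum>j<N. cnj (v i) * (\<Sum>c<m. b i c * cnj (b j c)) * \<kappa> (lam j) (lam i) * v j)"
    by (simp add: sum_distrib_left sum_distrib_right)
  finally have "ip (L v) (L v) - (\<Sum>c<m. ip (h c) (h c)) = (\<Sum>i<N. \<Sum>j<N.
      cnj (v i) * ((1 - (\<Sum>c<m. b i c * cnj (b j c))) * \<kappa> (lam j) (lam i)) * v j)"
    by (simp add: LL algebra_simps flip: sum_subtractf)
  also have "\<dots> = ?Q"
    using lam by (intro sum.cong refl) (simp add: \<kappa>_def r_def kfun_def mult_ac)
  finally have "?Q = of_real ((hnorm ip (L v))\<^sup>2 - S)"
    by (simp add: S_def ip_self hH LH)
  then show "Im ?Q = 0 \<and> 0 \<le> Re ?Q" using SG by simp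
qed

text \<open>Necessity in the McCullough--Quiggin theorem, by induction on the number of points: the
  claim with the first point as base yields a row-valued interpolation problem whose Pick
  matrix is of rank one, and compressing a solution to the functions vanishing at the new
  base point gives the claim for that base point.\<close>

lemma McCullough_Quiggin_necessity:
  assumes irr: "irreducible_kernel k" and pick: "complete_pick H ip k"
  shows "(\<And>j. j < n \<Longrightarrow> lam j \<in> disc) \<Longrightarrow> z0 \<in> disc \<Longrightarrow>
    psd_on {..<n::nat} (\<lambda>i j. 1 - k (lam i) z0 * k z0 (lam j) / (k z0 z0 * k (lam i) (lam j)))"
proof (induction n arbitrary: lam z0)
  case 0
  show ?case by (simp add: psd_on_def)
next
  case (Suc n)
  note lam = Suc.prems(1) and z0 = Suc.prems(2)
  have nz: "k z w \<noteq> 0" if "z \<in> disc" "w \<in> disc" for z w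
    using irr that by (auto simp: irreducible_kernel_def)
  define l where "l = lam 0"
  have l: "l \<in> disc" using lam[of 0] by (simp add: l_def)
  define T where "T i j = 1 - k (lam i) l * k l (lam j) / (k l l * k (lam i) (lam j))" for i j
  have "psd_on {..<n} (\<lambda>i j. T (Suc i) (Suc j))"
    unfolding T_def using Suc.IH[of "\<lambda>i. lam (Suc i)" l] lam l by simp
  \<comment> \<open>The row and column of the base point are zero, so the induction hypothesis for
    \<open>n\<close> points settles the matrix on \<open>Suc n\<close> points.\<close>
  moreover have "T 0 j = 0" "T j 0 = 0" if "j < Suc n" for j
    using that nz[OF l l] nz[OF l lam] nz[OF lam l] by (simp_all add: T_def flip: l_def)
  ultimately have "psd_on {..<Suc n} T"
    unfolding psd_on_def sum.lessThan_Suc_shift by simp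
  from psd_on_Gram[OF this] obtain b where
    b: "\<And>i j. i < Suc n \<Longrightarrow> j < Suc n \<Longrightarrow> T i j = (\<Sum>c<Suc n. b i c * cnj (b j c))" by blast
  \<comment> \<open>\<open>complete_pick\<close> speaks of square matrices, so the row
    \<open>b j\<close> is padded by zero rows.\<close>
  define A where "A j a c = (if a = (0::nat) then b j c else 0)" for j a c :: nat
  define s where "s = hnorm ip (kfun k l)"
  have kll: "k l l = of_real (s\<^sup>2)" using kernel_diag[OF l] by (simp add: s_def)
  have s: "s \<noteq> 0" using nz[OF l l] kll by auto
  \<comment> \<open>Diagonal blocks of the Pick matrix: the row \<open>b\<close> leaves the rank-one
    matrix k(lam i, l) k(l, lam j) / k(l, l), and each zero row leaves the kernel matrix
    itself.\<close>
  define E where "E a i j = (if a = (0::nat) then k (lam i) l / s * cnj (k (lam j) l / s)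
      else k (lam i) (lam j))" for a i j
  have E: "psd_on {..<Suc n} (E a)" for a
    unfolding E_def using psd_on_rank_one psd_on_kernel[of "{..<Suc n}" lam] lam
    by (cases "a = 0") (simp_all only: simp_thms if_True if_False lessThan_iff)
  have rank: "(1 - (\<Sum>c<Suc n. b i c * cnj (b j c))) * k (lam i) (lam j) = E 0 i j"
    if ij: "i < Suc n" "j < Suc n" for i j
    unfolding b[OF ij, symmetric] using nz[OF lam lam, OF ij] s l lam[OF ij(2)]
    by (simp add: T_def E_def kernel_cnj kll power2_eq_square)
  have "psd_on ({..<Suc n} \<times> {..<Suc n}) (pick_matrix k (Suc n) lam A)"
  proof (rule psd_on_cong[OF psd_on_block_diagonal[of "{..<Suc n}" "{..<Suc n}" E]])
    fix p r assume "p \<in> {..<Suc n} \<times> {..<Suc n}" "r \<in> {..<Suc n} \<times> {..<Suc n}"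
    then show "pick_matrix k (Suc n) lam A p r = (case p of (i, a) \<Rightarrow> \<lambda>(j, b). if a = b then E a i j else 0) r"
      using rank[of "fst p" "fst r"]
      by (auto simp: pick_matrix_def A_def E_def split: prod.splits simp del: sum.lessThan_Suc)
  qed (simp_all add: E)
  then have "\<exists>F. contractive_multiplier H ip (Suc n) F \<and>
      (\<forall>j<Suc n. \<forall>a<Suc n. \<forall>c<Suc n. F (lam j) a c = A j a c)"
    using pick lam unfolding complete_pick_def by simp
  then obtain F where F: "contractive_multiplier H ip (Suc n) F"
    and FA: "\<And>j c. j < Suc n \<Longrightarrow> c < Suc n \<Longrightarrow> F (lam j) 0 c = b j c"
    by (auto simp: A_def)
  define P where "P i j = (1 - (\<Sum>c<Suc n. b i c * cnj (b j c)))
           * (k (lam i) (lam j) - k (lam i) z0 * k z0 (lam j) / k z0 z0)" for i j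
  have "psd_on {..<Suc n} P"
    unfolding P_def by (rule psd_on_compression[OF F _ lam z0 nz[OF z0 z0] FA]) simp_all
  \<comment> \<open>By \<open>rank\<close>, \<open>P\<close> is the wanted matrix multiplied
    entrywise by a rank-one matrix without zero entries; a congruence with the reciprocals removes
    that factor.\<close>
  then have "psd_on {..<Suc n} (\<lambda>i j. s / k (lam i) l * P i j * cnj (s / k (lam j) l))"
    by (rule psd_on_congruence)
  then show ?case
  proof (rule psd_on_cong)
    fix i j assume "i \<in> {..<Suc n}" "j \<in> {..<Suc n}"
    then have ij: "i < Suc n" "j < Suc n" by auto
    note nz' = nz[OF lam lam, OF ij] nz[OF lam l, OF ij(1)] nz[OF l lam, OF ij(2)] nz[OF z0 z0]
    have "P i j = (1 - (\<Sum>c<Suc n. b i c * cnj (b j c))) * k (lam i) (lam j)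
        * (1 - k (lam i) z0 * k z0 (lam j) / (k z0 z0 * k (lam i) (lam j)))"
      unfolding P_def using nz' by (simp add: field_simps del: sum.lessThan_Suc)
    also have "\<dots> = k (lam i) l * k l (lam j) / (of_real s * of_real s)
        * (1 - k (lam i) z0 * k z0 (lam j) / (k z0 z0 * k (lam i) (lam j)))"
      unfolding rank[OF ij] using l lam[OF ij(2)] by (simp add: E_def kernel_cnj)
    finally show "1 - k (lam i) z0 * k z0 (lam j) / (k z0 z0 * k (lam i) (lam j))
        = s / k (lam i) l * P i j * cnj (s / k (lam j) l)"
      using nz' s l lam[OF ij(2)] by (simp add: kernel_cnj)
  qed
qed

end

section \<open>Averages over roots of unity\<close>

text \<open>The discrete Fourier transform at the N-th roots of unity returns the sum of all
  \<open>a l\<close> with \<open>l\<close> congruent to \<open>n\<close> modulo \<open>N\<close>.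
  Below \<open>N\<close> only \<open>a n\<close> survives, so the aliasing error is at most the tail
  from \<open>N\<close> on.\<close>

lemma roots_of_unity_average:
  fixes a :: "nat \<Rightarrow> complex"
  assumes summ: "summable (\<lambda>l. norm (a l))" and n: "n < N"
  shows "norm ((\<Sum>j<N. (\<Sum>l. a l * cis (2*pi/N) ^ (j*l)) * cnj (cis (2*pi/N) ^ (j*n))) / N - a n)
           \<le> (\<Sum>l. norm (a (l + N)))"
proof -
  define w where "w = cis (2*pi/N)"
  define D where "D l = (\<Sum>j<N. w ^ (j*l) * cnj (w ^ (j*n))) / N" for l
  have N: "N > 0" using n by simp
  have nw: "norm w = 1" by (simp add: w_def)
  have wN: "w ^ N = 1" using N by (simp add: w_def Complex.DeMoivre)
  have wc: "w ^ m * cnj (w ^ m) = 1" for m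
    by (metis complex_norm_square norm_power nw of_real_1 power_one)
  have D1: "norm (D l) \<le> 1" for l
  proof -
    have "norm (\<Sum>j<N. w ^ (j*l) * cnj (w ^ (j*n))) \<le> (\<Sum>j<N. 1)"
      by (rule sum_norm_le) (simp add: norm_mult norm_power nw)
    then show ?thesis using N by (simp add: D_def norm_divide)
  qed
  have Dn: "D n = 1" unfolding D_def wc using N by simp
  have D0: "D l = 0" if l: "l < N" "l \<noteq> n" for l
  proof -
    define x where "x = w ^ l * cnj (w ^ n)"
    have ww: "w ^ m = cis (2*pi*real m/real N)" for m
      by (simp add: w_def Complex.DeMoivre mult_ac)
    have "w ^ l \<noteq> w ^ n"
      using Complex.bij_betw_roots_unity[OF N] l n unfolding bij_betw_def inj_on_def ww by auto
    moreover have "x * w ^ n = w ^ l" using wc[of n] by (simp add: x_def algebra_simps)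
    ultimately have x1: "x \<noteq> 1" by auto
    have "x ^ N = (w ^ N) ^ l * cnj ((w ^ N) ^ n)"
      by (simp add: x_def power_mult_distrib mult.commute flip: power_mult)
    then have xN: "x ^ N = 1" by (simp add: wN)
    have "(\<Sum>j<N. w ^ (j*l) * cnj (w ^ (j*n))) = (\<Sum>j<N. x ^ j)"
      by (rule sum.cong) (simp_all add: x_def power_mult_distrib mult.commute flip: power_mult)
    also have "\<dots> = 0" using geometric_sum[OF x1, of N] xN by simp
    finally show ?thesis by (simp add: D_def)
  qed
  have s1: "summable (\<lambda>l. a l * (w ^ (j*l) * cnj (w ^ (j*n))))" for j
    by (rule summable_norm_cancel) (use summ in \<open>simp add: norm_mult norm_power nw\<close>)
  have s2: "summable (\<lambda>l. a l * w ^ (j*l))" for j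
    by (rule summable_norm_cancel) (use summ in \<open>simp add: norm_mult norm_power nw\<close>)
  have sn: "summable (\<lambda>l. norm (a l * D l))"
    by (rule summable_comparison_test[OF _ summ])
       (auto simp: norm_mult intro!: exI[of _ 0] mult_left_le D1)
  have sn': "summable (\<lambda>l. norm (a (l + N) * D (l + N)))"
    using summable_iff_shift[of "\<lambda>l. norm (a l * D l)" N] sn by simp
  have sN: "summable (\<lambda>l. norm (a (l + N)))"
    using summable_iff_shift[of "\<lambda>l. norm (a l)" N] summ by simp
  have "(\<Sum>j<N. (\<Sum>l. a l * w ^ (j*l)) * cnj (w ^ (j*n)))
      = (\<Sum>j<N. \<Sum>l. a l * (w ^ (j*l) * cnj (w ^ (j*n))))"
    using s2 by (intro sum.cong) (auto simp: suminf_mult2 mult.assoc)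
  also have "\<dots> = (\<Sum>l. \<Sum>j<N. a l * (w ^ (j*l) * cnj (w ^ (j*n))))"
    by (rule suminf_sum[symmetric]) (rule s1)
  also have "\<dots> / N = (\<Sum>l. (\<Sum>j<N. a l * (w ^ (j*l) * cnj (w ^ (j*n)))) / N)"
    by (rule suminf_divide[symmetric]) (intro summable_sum s1)
  also have "\<dots> = (\<Sum>l. a l * D l)"
    by (simp add: D_def sum_distrib_left)
  also have "\<dots> = (\<Sum>l. a (l + N) * D (l + N)) + (\<Sum>l<N. a l * D l)"
    by (rule suminf_split_initial_segment) (rule summable_norm_cancel[OF sn])
  also have "(\<Sum>l<N. a l * D l) = (\<Sum>l<N. if l = n then a n else 0)"
    by (rule sum.cong) (auto simp: D0 Dn)
  also have "\<dots> = a n" using n by simp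
  finally have eq: "(\<Sum>j<N. (\<Sum>l. a l * w ^ (j*l)) * cnj (w ^ (j*n))) / N - a n
      = (\<Sum>l. a (l + N) * D (l + N))" by simp
  have "norm (\<Sum>l. a (l + N) * D (l + N)) \<le> (\<Sum>l. norm (a (l + N) * D (l + N)))"
    by (rule summable_norm[OF sn'])
  also have "\<dots> \<le> (\<Sum>l. norm (a (l + N)))"
    by (rule suminf_le[OF _ sn' sN]) (auto simp: norm_mult intro!: mult_left_le D1)
  finally show ?thesis using eq unfolding w_def by simp
qed

text \<open>Averaging over \<open>j\<close> alone isolates \<open>b n\<close> up to a phase, with an
  error uniform in \<open>i\<close>; the factor \<open>cis (2*pi/M) ^ (i*n)\<close> cancels the
  phase exactly. Hence the bound depends on \<open>N\<close> only and \<open>M\<close> may be any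
  positive number.\<close>

lemma double_roots_of_unity_average:
  fixes b :: "nat \<Rightarrow> complex"
  assumes summ: "summable (\<lambda>l. norm (b l))" and n: "n < N" and M: "M > 0"
  shows "norm ((\<Sum>i<M. \<Sum>j<N. cis (2*pi/M) ^ (i*n) * cnj (cis (2*pi/N) ^ (j*n))
             * (\<Sum>l. b l * (cis (2*pi/N) ^ j * cnj (cis (2*pi/M) ^ i)) ^ l)) / (of_nat M * of_nat N) - b n)
           \<le> (\<Sum>l. norm (b (l + N)))"
proof -
  define v w where "v = cis (2*pi/M)" and "w = cis (2*pi/N)"
  define \<tau> where "\<tau> = (\<Sum>l. norm (b (l + N)))"
  have nv: "norm v = 1" by (simp add: v_def)
  define A where "A i = (\<Sum>j<N. (\<Sum>l. b l * cnj (v ^ i) ^ l * w ^ (j*l)) * cnj (w ^ (j*n))) / N" for i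
  have A: "norm (A i - b n * cnj (v ^ i) ^ n) \<le> \<tau>" for i
    using roots_of_unity_average[of "\<lambda>l. b l * cnj (v ^ i) ^ l", OF _ n] summ
    by (simp add: A_def w_def \<tau>_def norm_mult norm_power nv)
  have vv: "v ^ (i*n) * cnj (v ^ i) ^ n = 1" for i
  proof -
    have "v ^ (i*n) * cnj (v ^ i) ^ n = (v * cnj v) ^ (i*n)"
      by (simp add: power_mult_distrib flip: power_mult)
    then show ?thesis by (simp add: nv flip: complex_norm_square)
  qed
  have "(\<Sum>i<M. \<Sum>j<N. v ^ (i*n) * cnj (w ^ (j*n)) * (\<Sum>l. b l * (w ^ j * cnj (v ^ i)) ^ l)) / (of_nat M * of_nat N)
      = (\<Sum>i<M. v ^ (i*n) * A i) / M"
    by (simp add: A_def sum_distrib_left sum_divide_distrib power_mult_distrib mult_ac flip: power_mult)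
  also have "\<dots> - b n = (\<Sum>i<M. v ^ (i*n) * (A i - b n * cnj (v ^ i) ^ n)) / M"
  proof -
    have "v ^ (i*n) * (A i - b n * cnj (v ^ i) ^ n) = v ^ (i*n) * A i - b n" for i
      using vv[of i] by (simp add: right_diff_distrib mult.left_commute)
    then have "(\<Sum>i<M. v ^ (i*n) * (A i - b n * cnj (v ^ i) ^ n)) = (\<Sum>i<M. v ^ (i*n) * A i) - of_nat M * b n"
      by (simp only: sum_subtractf sum_constant card_lessThan)
    then show ?thesis using M by (simp add: diff_divide_distrib)
  qed
  finally have eq: "(\<Sum>i<M. \<Sum>j<N. v ^ (i*n) * cnj (w ^ (j*n)) * (\<Sum>l. b l * (w ^ j * cnj (v ^ i)) ^ l)) / (of_nat M * of_nat N) - b n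
      = (\<Sum>i<M. v ^ (i*n) * (A i - b n * cnj (v ^ i) ^ n)) / M" .
  have "norm (\<Sum>i<M. v ^ (i*n) * (A i - b n * cnj (v ^ i) ^ n)) \<le> (\<Sum>i<M. \<tau>)"
    by (rule sum_norm_le) (use A in \<open>simp add: norm_mult norm_power nv\<close>)
  then have "norm ((\<Sum>i<M. v ^ (i*n) * (A i - b n * cnj (v ^ i) ^ n)) / M) \<le> \<tau>"
    using M by (simp add: norm_divide field_simps)
  then show ?thesis using eq by (simp add: v_def w_def \<tau>_def)
qed

text \<open>Take N equally spaced points on the circle of radius 1/2, so that products
  \<open>lam i * cnj (lam j)\<close> have modulus 1/4. The form at the n-th character, divided by
  N^2, tends to \<open>a n * (1/4) ^ n\<close>, and being real and nonnegative passes to the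
  limit.\<close>

lemma psd_power_series_coeffs_nonneg:
  fixes a :: "nat \<Rightarrow> complex"
  assumes sums: "\<And>t. norm t < 1 \<Longrightarrow> (\<lambda>l. a l * t ^ l) sums \<phi> t"
    and psd: "\<And>N lam. (\<And>j. j < N \<Longrightarrow> norm (lam j) < 1) \<Longrightarrow>
      psd_on {..<N::nat} (\<lambda>i j. \<phi> (lam i * cnj (lam j)))"
  shows "Im (a n) = 0 \<and> 0 \<le> Re (a n)"
proof -
  define b where "b l = a l * (1/4) ^ l" for l
  have summ: "summable (\<lambda>l. norm (b l))"
    unfolding b_def by (rule powser_insidea[of _ "1/2"]) (use sums[of "1/2"] in \<open>auto simp: sums_iff\<close>)
  define w where "w N = cis (2*pi/real N)" for N
  define S where "S N = (\<Sum>i<N. \<Sum>j<N. w N ^ (i*n) * cnj (w N ^ (j*n))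
             * (\<Sum>l. b l * (w N ^ j * cnj (w N ^ i)) ^ l)) / (of_nat N * of_nat N)" for N :: nat
  have S: "Im (S N) = 0 \<and> 0 \<le> Re (S N)" for N
  proof -
    define lam where "lam j = w N ^ j / 2" for j
    define T where "T = (\<Sum>i<N. \<Sum>j<N. cnj (w N ^ (i*n)) * \<phi> (lam i * cnj (lam j)) * w N ^ (j*n))"
    have nl: "norm (lam j) = 1/2" for j by (simp add: lam_def w_def norm_divide norm_power)
    have "(\<Sum>l. b l * (w N ^ i * cnj (w N ^ j)) ^ l) = \<phi> (lam i * cnj (lam j))" for i j
    proof -
      have "lam i * cnj (lam j) = w N ^ i * cnj (w N ^ j) * (1/4)" by (simp add: lam_def)
      then have "b l * (w N ^ i * cnj (w N ^ j)) ^ l = a l * (lam i * cnj (lam j)) ^ l" for l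
        by (simp only: b_def power_mult_distrib[of "w N ^ i * cnj (w N ^ j)"]) (simp add: mult_ac)
      then show ?thesis using sums[of "lam i * cnj (lam j)"] by (simp add: sums_iff norm_mult nl)
    qed
    then have "T = (\<Sum>i<N. \<Sum>j<N. w N ^ (j*n) * cnj (w N ^ (i*n)) * (\<Sum>l. b l * (w N ^ i * cnj (w N ^ j)) ^ l))"
      unfolding T_def by (simp add: mult_ac)
    also have "\<dots> = (\<Sum>i<N. \<Sum>j<N. w N ^ (i*n) * cnj (w N ^ (j*n)) * (\<Sum>l. b l * (w N ^ j * cnj (w N ^ i)) ^ l))"
      by (rule sum.swap)
    finally have ST: "S N = T / of_real (real N * real N)" by (simp add: S_def)
    have "psd_on {..<N} (\<lambda>i j. \<phi> (lam i * cnj (lam j)))" by (rule psd) (simp add: nl)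
    from spec[OF this[unfolded psd_on_def], of "\<lambda>i. w N ^ (i*n)"]
    have "Im T = 0 \<and> 0 \<le> Re T" by (simp only: T_def)
    then show ?thesis unfolding ST by (simp add: Im_divide_of_real Re_divide_of_real)
  qed
  have "S \<longlonglongrightarrow> b n"
  proof (rule LIM_zero_cancel, rule Lim_null_comparison)
    show "\<forall>\<^sub>F N in sequentially. norm (S N - b n) \<le> (\<Sum>l. norm (b (l + N)))"
      using eventually_gt_at_top[of n]
      by eventually_elim (use double_roots_of_unity_average[OF summ] in \<open>simp add: S_def w_def\<close>)
    show "(\<lambda>N. \<Sum>l. norm (b (l + N))) \<longlonglongrightarrow> 0" by (rule suminf_exist_split2[OF summ])
  qed
  then have "(\<lambda>N. Im (S N)) \<longlonglongrightarrow> Im (b n)" "(\<lambda>N. Re (S N)) \<longlonglongrightarrow> Re (b n)"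
    by (auto intro: tendsto_intros)
  then have "Im (b n) = 0" "0 \<le> Re (b n)"
    using S by (auto simp: LIMSEQ_const_iff intro: LIMSEQ_le_const)
  moreover have "b n = a n * of_real ((1/4) ^ n)" by (simp add: b_def)
  ultimately show ?thesis
    using mult_le_cancel_right_pos[of "(1/4) ^ n" 0 "Re (a n)"]
    by (simp del: of_real_power)
qed

section \<open>Spaces with diagonal kernels\<close>

lemma taylor0_sums:
  assumes "f holomorphic_on ball 0 r" "norm z < r"
  shows "(\<lambda>n. taylor0 f n * z ^ n) sums f z"
  using holomorphic_power_series[OF assms(1), of z] assms(2) by (simp add: taylor0_def)

lemma taylor0_unique:
  assumes sums: "\<And>z. norm z < 1 \<Longrightarrow> (\<lambda>n. a n * z ^ n) sums f z"
  shows "taylor0 f n = a n"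
proof -
  have "conv_radius a \<ge> norm (1/2 :: complex)"
    by (rule conv_radius_geI) (use sums[of "1/2"] in \<open>simp add: sums_iff\<close>)
  then have "fps_conv_radius (Abs_fps a) > 0"
    by (simp add: fps_conv_radius_def less_le_trans[of 0 "ereal (1/2)"])
  moreover have "eventually (\<lambda>z. z \<in> ball 0 1) (nhds (0::complex))"
    by (rule eventually_nhds_in_open) auto
  then have "eventually (\<lambda>z. eval_fps (Abs_fps a) z = f z) (nhds 0)"
    by (rule eventually_mono) (use sums in \<open>auto simp: eval_fps_def sums_iff\<close>)
  ultimately have "f has_fps_expansion Abs_fps a" by (simp add: has_fps_expansion_def)
  from fps_nth_fps_expansion[OF this, of n] show ?thesis by (simp add: taylor0_def)
qed

section \<open>Monomials and the norm for a kernel that is a power series in z cnj w\<close>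

context rkhs_disc
begin

lemma ip_comb_right:
  assumes "f \<in> H" "\<And>j. j \<in> A \<Longrightarrow> g j \<in> H"
  shows "ip f (\<lambda>z. \<Sum>j\<in>A. x j * g j z) = (\<Sum>j\<in>A. cnj (x j) * ip f (g j))"
  using ip_sum_right[of A "\<lambda>j z. x j * g j z" f] assms by (simp add: H_scale ip_scale_right)

lemma ip_comb_left:
  assumes "f \<in> H" "\<And>j. j \<in> A \<Longrightarrow> g j \<in> H"
  shows "ip (\<lambda>z. \<Sum>j\<in>A. x j * g j z) f = (\<Sum>j\<in>A. x j * ip (g j) f)"
  using ip_sum_left[of A "\<lambda>j z. x j * g j z" f] assms by (simp add: H_scale ip_scale_left)

lemma H_comb: "(\<And>j. j \<in> A \<Longrightarrow> g j \<in> H) \<Longrightarrow> (\<lambda>z. \<Sum>j\<in>A. x j * g j z) \<in> H"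
  by (intro H_sum H_scale)

lemma hnorm_diff_sq:
  assumes f: "f \<in> H" and g: "g \<in> H"
  shows "of_real ((hnorm ip (\<lambda>z. f z - g z))\<^sup>2) = ip f f - ip f g - ip g f + ip g g"
  using ip_self[OF H_diff[OF f g]] ip_diff_left[OF f g H_diff[OF f g]]
    ip_diff_right[OF f f g] ip_diff_right[OF g f g] by (simp add: algebra_simps)

text \<open>Averaging the kernel functions over roots of unity isolates one monomial.\<close>

lemma monomial_in_H:
  fixes \<beta> :: "nat \<Rightarrow> real"
  assumes hol: "\<And>f. f \<in> H \<Longrightarrow> f holomorphic_on disc"
    and ksums: "\<And>z w. z \<in> disc \<Longrightarrow> w \<in> disc \<Longrightarrow> (\<lambda>l. of_real (\<beta> l) * (z * cnj w) ^ l) sums k z w"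
    and \<beta>: "\<beta> n > 0"
  shows "(\<lambda>z. if z \<in> disc then z ^ n else 0) \<in> H" (is "?e \<in> H")
    and "f \<in> H \<Longrightarrow> ip f (\<lambda>z. if z \<in> disc then z ^ n else 0) = taylor0 f n / \<beta> n"
proof -
  define w where "w N = cis (2*pi/real N)" for N
  define p where "p N j = w N ^ j / 2" for N j
  have pn: "norm (p N j) = 1/2" for N j by (simp add: p_def w_def norm_divide norm_power)
  have pd: "p N j \<in> disc" for N j using pn[of N j] by (simp add: disc_def)
  \<comment> \<open>Pairing \<open>f\<close> with \<open>G N\<close> gives the N-point Fourier
    coefficient of \<open>f\<close> of index \<open>n\<close> on the circle of radius 1/2, an
    approximation of \<open>taylor0 f n * (1/2) ^ n\<close>. So \<open>G N\<close> is expected to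
    converge to a multiple of the monomial.\<close>
  define G where "G N = (\<lambda>z. \<Sum>j<N. w N ^ (j*n) / N * kfun k (p N j) z)" for N
  have G: "G N \<in> H" for N unfolding G_def by (intro H_comb kfun_in pd)
  have fG: "ip f (G N) = (\<Sum>j<N. cnj (w N ^ (j*n) / N) * f (p N j))" if "f \<in> H" for f N
    unfolding G_def ip_comb_right[OF that kfun_in[OF pd]] using that by (simp add: pd reproducing)
  have lim: "(\<lambda>N. ip f (G N)) \<longlonglongrightarrow> taylor0 f n * (1/2) ^ n" if f: "f \<in> H" for f
  proof -
    define a where "a l = taylor0 f l * (1/2) ^ l" for l
    have ts: "(\<lambda>l. taylor0 f l * z ^ l) sums f z" if "norm z < 1" for z
      using taylor0_sums[of f 1 z] hol[OF f] that by (simp add: disc_def)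
    have summ: "summable (\<lambda>l. norm (a l))"
      unfolding a_def by (rule powser_insidea[of _ "3/4"]) (use ts[of "3/4"] in \<open>auto simp: sums_iff\<close>)
    have fp: "f (p N j) = (\<Sum>l. a l * w N ^ (j*l))" for N j
    proof -
      have "a l * w N ^ (j*l) = taylor0 f l * p N j ^ l" for l
        by (simp add: a_def p_def power_divide field_simps flip: power_mult)
      then show ?thesis using ts[of "p N j"] by (simp add: sums_iff pn)
    qed
    have "ip f (G N) = (\<Sum>j<N. (\<Sum>l. a l * w N ^ (j*l)) * cnj (w N ^ (j*n))) / N" for N
      by (simp add: fG[OF f] fp sum_divide_distrib mult_ac)
    then have "norm (ip f (G N) - a n) \<le> (\<Sum>l. norm (a (l + N)))" if "n < N" for N
      using roots_of_unity_average[OF summ that] by (simp add: w_def)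
    then have "(\<lambda>N. ip f (G N)) \<longlonglongrightarrow> a n"
      by (intro LIM_zero_cancel[OF Lim_null_comparison[OF _ suminf_exist_split2[OF summ]]])
        (auto intro: eventually_mono[OF eventually_gt_at_top[of n]])
    then show ?thesis by (simp add: a_def)
  qed
  define b where "b l = complex_of_real (\<beta> l * (1/4) ^ l)" for l
  have bsumm: "summable (\<lambda>l. norm (b l))"
  proof -
    have "summable (\<lambda>l. complex_of_real (\<beta> l) * (1/2) ^ l)"
      using ksums[of "3/4" "2/3"] by (simp add: sums_iff disc_def)
    from powser_insidea[OF this, of "1/4"] show ?thesis by (simp add: b_def)
  qed
  define \<tau> where "\<tau> N = (\<Sum>l. norm (b (l + N)))" for N
  have GG: "norm (ip (G M) (G N) - b n) \<le> \<tau> N" if "n < N" "n < M" for M N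
  proof -
    have kp: "k (p N j) (p M i) = (\<Sum>l. b l * (w N ^ j * cnj (w M ^ i)) ^ l)" for i j
    proof -
      have "b l * (w N ^ j * cnj (w M ^ i)) ^ l = of_real (\<beta> l) * (p N j * cnj (p M i)) ^ l" for l
      proof -
        have "p N j * cnj (p M i) = w N ^ j * cnj (w M ^ i) * (1/4)" by (simp add: p_def)
        then show ?thesis
          by (simp only: b_def power_mult_distrib[of "w N ^ j * cnj (w M ^ i)"]) (simp add: mult_ac)
      qed
      then show ?thesis using ksums[OF pd pd, of N j M i] by (simp add: sums_iff)
    qed
    have "ip (G M) (G N) = (\<Sum>j<N. cnj (w N ^ (j*n) / N) * G M (p N j))" by (rule fG[OF G])
    also have "\<dots> = (\<Sum>j<N. \<Sum>i<M. cnj (w N ^ (j*n) / N) * (w M ^ (i*n) / M * k (p N j) (p M i)))"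
      using pd by (simp add: G_def sum_distrib_left kfun_def)
    also have "\<dots> = (\<Sum>i<M. \<Sum>j<N. cnj (w N ^ (j*n) / N) * (w M ^ (i*n) / M * k (p N j) (p M i)))"
      by (rule sum.swap)
    also have "\<dots> = (\<Sum>i<M. \<Sum>j<N. w M ^ (i*n) * cnj (w N ^ (j*n))
        * (\<Sum>l. b l * (w N ^ j * cnj (w M ^ i)) ^ l)) / (of_nat M * of_nat N)"
      unfolding kp sum_divide_distrib by (intro sum.cong refl) (simp add: mult_ac)
    finally show ?thesis
      using double_roots_of_unity_average[OF bsumm, of n N M] that by (simp add: w_def \<tau>_def)
  qed
  have \<tau>: "\<tau> \<longlonglongrightarrow> 0" unfolding \<tau>_def by (rule suminf_exist_split2[OF bsumm])
  \<comment> \<open>All inner products of the \<open>G i\<close> approach the same number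
    \<open>b n\<close>. In the expansion of the squared norm of a difference the four copies of
    \<open>b n\<close> cancel, leaving four errors, each below a quarter of \<open>e\<close>
    squared.\<close>
  have "\<exists>N. \<forall>i\<ge>N. \<forall>j\<ge>N. hnorm ip (\<lambda>z. G i z - G j z) < e" if e: "e > 0" for e
  proof -
    have "eventually (\<lambda>N. norm (\<tau> N) < e\<^sup>2 / 4) sequentially"
      using tendstoD[OF \<tau>, of "e\<^sup>2 / 4"] e by (simp add: dist_norm)
    then have "eventually (\<lambda>N. n < N \<and> \<tau> N < e\<^sup>2 / 4) sequentially"
      using eventually_gt_at_top[of n] by eventually_elim auto
    then obtain N where N: "\<And>i. i \<ge> N \<Longrightarrow> n < i \<and> \<tau> i < e\<^sup>2 / 4"
      by (auto simp: eventually_sequentially)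
    have "hnorm ip (\<lambda>z. G i z - G j z) < e" if "i \<ge> N" "j \<ge> N" for i j
    proof -
      note ni = N[OF that(1)] N[OF that(2)]
      have *: "norm (ip (G j) (G i) - b n) \<le> \<tau> j"
      proof -
        have "ip (G j) (G i) - b n = cnj (ip (G i) (G j) - b n)"
          using ip_cnj[OF G G, of i j] by (simp add: b_def)
        then show ?thesis using GG[of j i] ni by (simp only: complex_mod_cnj)
      qed
      have tri: "norm (x - y - z + u) \<le> norm x + norm y + norm z + norm u" for x y z u :: complex
        using norm_triangle_ineq[of "x - y - z" u] norm_triangle_ineq4[of "x - y" z] norm_triangle_ineq4[of x y]
        by linarith
      from * have le: "norm (ip (G i) (G i) - b n) \<le> \<tau> i" "norm (ip (G i) (G j) - b n) \<le> \<tau> j"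
        "norm (ip (G j) (G i) - b n) \<le> \<tau> j" "norm (ip (G j) (G j) - b n) \<le> \<tau> j"
        using GG[of i i] GG[of j i] GG[of j j] ni by auto
      have "complex_of_real ((hnorm ip (\<lambda>z. G i z - G j z))\<^sup>2)
        = (ip (G i) (G i) - b n) - (ip (G i) (G j) - b n) - (ip (G j) (G i) - b n) + (ip (G j) (G j) - b n)"
        using hnorm_diff_sq[OF G G, of i j] by simp
      then have "norm (complex_of_real ((hnorm ip (\<lambda>z. G i z - G j z))\<^sup>2))
        \<le> norm (ip (G i) (G i) - b n) + norm (ip (G i) (G j) - b n) + norm (ip (G j) (G i) - b n)
          + norm (ip (G j) (G j) - b n)"
        by (simp only: tri)
      then have "(hnorm ip (\<lambda>z. G i z - G j z))\<^sup>2 < e\<^sup>2"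
        using le ni unfolding norm_of_real by simp
      then show ?thesis using e by (simp add: power2_less_imp_less)
    qed
    then show ?thesis by blast
  qed
  from H_complete[OF G this] obtain g where g: "g \<in> H"
    and Gg: "(\<lambda>N. hnorm ip (\<lambda>z. G N z - g z)) \<longlonglongrightarrow> 0" by blast
  have fg: "ip f g = taylor0 f n * (1/2) ^ n" if f: "f \<in> H" for f
  proof (rule LIMSEQ_unique[OF _ lim[OF f]])
    have "(\<lambda>N. cnj (ip (G N) f)) \<longlonglongrightarrow> cnj (ip g f)"
      by (intro tendsto_cnj ip_tendsto G g f Gg)
    then show "(\<lambda>N. ip f (G N)) \<longlonglongrightarrow> ip f g"
      using ip_cnj[OF G f] ip_cnj[OF g f] by simp
  qed
  \<comment> \<open>The value \<open>g z\<close> is the conjugate of \<open>ip (kfun k z) g\<close>,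
    which reads off the n-th Taylor coefficient of the kernel function. Hence \<open>g\<close> is
    \<open>\<beta> n / 2 ^ n\<close> times the monomial, and \<open>c\<close> undoes this
    factor.\<close>
  define c where "c = complex_of_real (2 ^ n / \<beta> n)"
  have gz: "c * g z = ?e z" for z
  proof (cases "z \<in> disc")
    case True
    have "taylor0 (kfun k z) n = of_real (\<beta> n) * cnj z ^ n"
    proof (rule taylor0_unique)
      fix u :: complex assume "norm u < 1"
      then have "u \<in> disc" by (simp add: disc_def)
      then show "(\<lambda>n. of_real (\<beta> n) * cnj z ^ n * u ^ n) sums kfun k z u"
        using ksums[of u z] True by (simp add: kfun_def power_mult_distrib mult_ac)
    qed
    then have "cnj (ip (kfun k z) g) = of_real (\<beta> n) * z ^ n * (1/2) ^ n"
      by (simp add: fg[OF kfun_in[OF True]])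
    then have "g z = of_real (\<beta> n) * z ^ n * (1/2) ^ n"
      using reproducing[OF True g] ip_cnj[OF kfun_in[OF True] g] by simp
    then show ?thesis using True \<beta> by (simp add: c_def field_simps)
  qed (use H_outside[OF g] in simp)
  have e: "?e = (\<lambda>z. c * g z)" using gz by auto
  show "?e \<in> H" unfolding e by (rule H_scale[OF g])
  show "ip f ?e = taylor0 f n / \<beta> n" if f: "f \<in> H"
    unfolding e using ip_scale_right[OF f g, of c] fg[OF f] \<beta> by (simp add: c_def field_simps)
qed

text \<open>The monomials are orthogonal with squared norm \<open>1 / \<beta> n\<close>, which makes
  the norm a weighted square sum of Taylor coefficients. Weights between positive constants single
  out the same functions as plain square summability.\<close>

lemma diagonal_kernel_hardy2:
  fixes \<beta> :: "nat \<Rightarrow> real"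
  assumes hol: "\<And>f. f \<in> H \<Longrightarrow> f holomorphic_on disc"
    and ksums: "\<And>z w. z \<in> disc \<Longrightarrow> w \<in> disc \<Longrightarrow> (\<lambda>l. of_real (\<beta> l) * (z * cnj w) ^ l) sums k z w"
    and m: "0 < m" and lower: "\<And>n. m \<le> \<beta> n" and upper: "\<And>n. \<beta> n \<le> M"
  shows "H = hardy2"
    and "f \<in> H \<Longrightarrow> (\<lambda>n. (cmod (taylor0 f n))\<^sup>2 / \<beta> n) sums (hnorm ip f)\<^sup>2"
proof -
  have \<beta>: "\<beta> n > 0" for n using m lower[of n] by simp
  define e where "e n = (\<lambda>z::complex. if z \<in> disc then z ^ n else 0)" for n
  have eH: "e n \<in> H" for n unfolding e_def by (rule monomial_in_H(1)[OF hol ksums \<beta>])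
  have fe: "ip f (e n) = taylor0 f n / \<beta> n" if "f \<in> H" for f n
    unfolding e_def by (rule monomial_in_H(2)[OF hol ksums \<beta> that])
  have te: "taylor0 (e n) l = (if l = n then 1 else 0)" for n l
  proof (rule taylor0_unique)
    fix z :: complex assume "norm z < 1"
    then show "(\<lambda>l. (if l = n then 1 else 0) * z ^ l) sums e n z"
      using sums_single[of n "\<lambda>l. z ^ l"] by (simp add: e_def disc_def if_distrib[of "\<lambda>x. x * _"] cong: if_cong)
  qed
  define S where "S a A = (\<lambda>z. \<Sum>n\<in>A. a n * e n z)" for a :: "nat \<Rightarrow> complex" and A
  have SH: "S a A \<in> H" for a A unfolding S_def by (intro H_comb eH)
  have fS: "ip f (S a A) = (\<Sum>n\<in>A. cnj (a n) * taylor0 f n / \<beta> n)" if "f \<in> H" for f a A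
    unfolding S_def using ip_comb_right[OF that, of A e a] by (simp add: eH fe[OF that])
  have Sf: "ip (S a A) f = (\<Sum>n\<in>A. a n * cnj (taylor0 f n) / \<beta> n)" if "f \<in> H" for f a A
    using ip_cnj[OF that SH] fS[OF that] by simp
  have SS: "(hnorm ip (S a A))\<^sup>2 = (\<Sum>n\<in>A. (cmod (a n))\<^sup>2 / \<beta> n)" if "finite A" for a A
  proof -
    have "ip (S a A) (S a A) = (\<Sum>n\<in>A. a n * ip (e n) (S a A))"
      using ip_comb_left[OF SH, of A e a a A] by (simp add: S_def eH)
    also have "\<dots> = (\<Sum>n\<in>A. of_real ((cmod (a n))\<^sup>2 / \<beta> n))"
      using that by (intro sum.cong refl)
        (simp add: fS eH te if_distrib[of "\<lambda>x. _ * x"] if_distrib[of "\<lambda>x. x / _"] complex_norm_square del: of_real_power cong: if_cong)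
    finally have "complex_of_real ((hnorm ip (S a A))\<^sup>2) = of_real (\<Sum>n\<in>A. (cmod (a n))\<^sup>2 / \<beta> n)"
      by (simp only: ip_self[OF SH] of_real_sum)
    then show ?thesis by (simp only: of_real_eq_iff)
  qed
  \<comment> \<open>Bessel's inequality: the Taylor section \<open>P\<close> is the orthogonal
    projection of \<open>f\<close> onto the span of finitely many monomials.\<close>
  have summ1: "summable (\<lambda>n. (cmod (taylor0 f n))\<^sup>2 / \<beta> n)" if f: "f \<in> H" for f
  proof (rule bounded_imp_summable)
    show "0 \<le> (cmod (taylor0 f n))\<^sup>2 / \<beta> n" for n using \<beta>[of n] by simp
    fix n
    define P where "P = S (taylor0 f) {..n}"
    define t where "t = (\<Sum>n\<le>n. (cmod (taylor0 f n))\<^sup>2 / \<beta> n)"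
    have 1: "ip f P = of_real t" "ip P f = of_real t" "ip P P = of_real t"
      using fS[OF f, of "taylor0 f" "{..n}"] Sf[OF f, of "taylor0 f" "{..n}"] SS[of "{..n}" "taylor0 f"] ip_self[OF SH]
      by (simp_all add: P_def t_def complex_norm_square mult.commute del: of_real_power)
    have "complex_of_real ((hnorm ip (\<lambda>z. f z - P z))\<^sup>2) = of_real ((hnorm ip f)\<^sup>2 - t)"
      using hnorm_diff_sq[OF f, of P] SH 1 by (simp add: P_def ip_self[OF f])
    then have "(hnorm ip (\<lambda>z. f z - P z))\<^sup>2 = (hnorm ip f)\<^sup>2 - t" by (simp only: of_real_eq_iff)
    then show "(\<Sum>k\<le>n. (cmod (taylor0 f k))\<^sup>2 / \<beta> k) \<le> (hnorm ip f)\<^sup>2"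
      unfolding t_def[symmetric] using zero_le_power2[of "hnorm ip (\<lambda>z. f z - P z)"] by linarith
  qed
  \<comment> \<open>Membership in \<open>H\<close> is a conclusion here, so one argument gives both
    the norm formula on \<open>H\<close> and the inclusion of \<open>hardy2\<close> in
    \<open>H\<close>. The Taylor sections are Cauchy, and point evaluations identify their limit
    with \<open>f\<close>.\<close>
  have approx: "f \<in> H \<and> (\<lambda>n. (cmod (taylor0 f n))\<^sup>2 / \<beta> n) sums (hnorm ip f)\<^sup>2"
    if f: "f holomorphic_on disc" and out: "\<And>z. z \<notin> disc \<Longrightarrow> f z = 0"
      and summ: "summable (\<lambda>n. (cmod (taylor0 f n))\<^sup>2 / \<beta> n)" for f
  proof -
    define T where "T N = S (taylor0 f) {..<N}" for N
    have T: "T N \<in> H" for N by (simp add: T_def SH)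
    have T2: "(hnorm ip (\<lambda>z. T j z - T i z))\<^sup>2 = (\<Sum>n\<in>{i..<j}. (cmod (taylor0 f n))\<^sup>2 / \<beta> n)"
      if "i \<le> j" for i j
    proof -
      have "{..<j} = {..<i} \<union> {i..<j}" "{..<i} \<inter> {i..<j} = {}" using that by auto
      then have "(\<lambda>z. T j z - T i z) = S (taylor0 f) {i..<j}"
        by (auto simp: T_def S_def sum.union_disjoint)
      then show ?thesis by (simp add: SS)
    qed
    have sym: "hnorm ip (\<lambda>z. T i z - T j z) = hnorm ip (\<lambda>z. T j z - T i z)" for i j
    proof -
      have "complex_of_real ((hnorm ip (\<lambda>z. T i z - T j z))\<^sup>2) = of_real ((hnorm ip (\<lambda>z. T j z - T i z))\<^sup>2)"
        unfolding hnorm_diff_sq[OF T T] by simp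
      then show ?thesis
        using hnorm_nonneg[OF H_diff[OF T T]] by (simp only: of_real_eq_iff) (rule power2_eq_imp_eq; simp)
    qed
    have "\<exists>N. \<forall>i\<ge>N. \<forall>j\<ge>N. hnorm ip (\<lambda>z. T i z - T j z) < \<epsilon>" if \<epsilon>: "\<epsilon> > 0" for \<epsilon>
    proof -
      have "\<epsilon>\<^sup>2 > 0" using \<epsilon> by simp
      from summ[unfolded summable_Cauchy, rule_format, OF this] obtain N where
        N: "\<And>i j. i \<ge> N \<Longrightarrow> norm (\<Sum>n\<in>{i..<j}. (cmod (taylor0 f n))\<^sup>2 / \<beta> n) < \<epsilon>\<^sup>2" by blast
      have *: "hnorm ip (\<lambda>z. T j z - T i z) < \<epsilon>" if "i \<ge> N" "i \<le> j" for i j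
      proof -
        have "(hnorm ip (\<lambda>z. T j z - T i z))\<^sup>2 < \<epsilon>\<^sup>2"
          unfolding T2[OF that(2)] using N[OF that(1), of j] by simp
        then show ?thesis using \<epsilon> by (simp add: power2_less_imp_less)
      qed
      show ?thesis using * sym by (metis nat_le_linear)
    qed
    from H_complete[OF T this] obtain g where g: "g \<in> H"
      and Tg: "(\<lambda>N. hnorm ip (\<lambda>z. T N z - g z)) \<longlonglongrightarrow> 0" by blast
    have "g z = f z" for z
    proof (cases "z \<in> disc")
      case True
      have "(\<lambda>N. T N z) \<longlonglongrightarrow> g z"
        using ip_tendsto[OF T g kfun_in[OF True] Tg] by (simp add: reproducing True T g)
      moreover have "(\<lambda>N. T N z) \<longlonglongrightarrow> f z"
        using taylor0_sums[of f 1 z] f True by (simp add: T_def S_def e_def sums_def disc_def)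
      ultimately show ?thesis by (rule LIMSEQ_unique)
    qed (simp add: out H_outside[OF g])
    then have gf: "g = f" by auto
    then have fH: "f \<in> H" using g by simp
    have "(\<lambda>N. ip (T N) f) \<longlonglongrightarrow> ip f f"
      using ip_tendsto[OF T g fH Tg] by (simp add: gf)
    moreover have "ip (T N) f = of_real (\<Sum>n<N. (cmod (taylor0 f n))\<^sup>2 / \<beta> n)" for N
      by (simp add: T_def Sf[OF fH] complex_norm_square del: of_real_power)
    ultimately have "(\<lambda>N. \<Sum>n<N. (cmod (taylor0 f n))\<^sup>2 / \<beta> n) \<longlonglongrightarrow> (hnorm ip f)\<^sup>2"
      by (simp only: ip_self[OF fH] tendsto_of_real_iff)
    then show ?thesis using fH by (simp add: sums_def)
  qed
  show "(\<lambda>n. (cmod (taylor0 f n))\<^sup>2 / \<beta> n) sums (hnorm ip f)\<^sup>2" if "f \<in> H" for f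
    using approx[OF hol[OF that] H_outside[OF that] summ1[OF that]] by blast
  show "H = hardy2"
  proof (intro equalityI subsetI)
    fix f assume f: "f \<in> H"
    have "summable (\<lambda>n. (cmod (taylor0 f n))\<^sup>2)"
    proof (rule summable_comparison_test)
      show "summable (\<lambda>n. M * ((cmod (taylor0 f n))\<^sup>2 / \<beta> n))" by (intro summable_mult summ1 f)
      show "\<exists>N. \<forall>n\<ge>N. norm ((cmod (taylor0 f n))\<^sup>2) \<le> M * ((cmod (taylor0 f n))\<^sup>2 / \<beta> n)"
        using upper \<beta> by (auto simp: field_simps mult_right_mono)
    qed
    then show "f \<in> hardy2" using hol[OF f] H_outside[OF f] by (simp add: hardy2_def)
  next
    fix f assume "f \<in> hardy2"
    then have f: "f holomorphic_on disc" "\<And>z. z \<notin> disc \<Longrightarrow> f z = 0"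
      and s: "summable (\<lambda>n. (cmod (taylor0 f n))\<^sup>2)" by (auto simp: hardy2_def)
    have "summable (\<lambda>n. (cmod (taylor0 f n))\<^sup>2 / \<beta> n)"
    proof (rule summable_comparison_test)
      show "summable (\<lambda>n. (cmod (taylor0 f n))\<^sup>2 / m)" by (intro summable_divide s)
      show "\<exists>N. \<forall>n\<ge>N. norm ((cmod (taylor0 f n))\<^sup>2 / \<beta> n) \<le> (cmod (taylor0 f n))\<^sup>2 / m"
        using lower \<beta> m by (auto intro!: divide_left_mono mult_pos_pos simp: abs_of_pos)
    qed
    then show "f \<in> H" using approx[OF f] by blast
  qed
qed

end

section \<open>Renewal sequences\<close>

text \<open>Renewal sequences with geometrically decaying increments are bounded below: with the
  tails v the renewal equation telescopes to a convolution identity v * b = 1, so every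
  window of bounded length contains a term of b that is not small.\<close>

lemma renewal_bounds:
  fixes c b :: "nat \<Rightarrow> real" and \<rho> :: real
  assumes c0: "c 0 = 0" and cpos: "\<And>n. 0 \<le> c n" and c1: "c 1 > 0"
    and sums: "c sums 1" and \<rho>: "\<rho> > 1" and summ: "summable (\<lambda>n. c n * \<rho> ^ n)"
    and b0: "b 0 = 1" and bS: "\<And>n. n > 0 \<Longrightarrow> b n = (\<Sum>i\<le>n. c i * b (n - i))"
  shows "\<exists>m>0. \<forall>n. m \<le> b n \<and> b n \<le> 1"
proof -
  have bnn: "0 \<le> b n" for n
  proof (induction n rule: less_induct)
    case (less n)
    show ?case
    proof (cases "n = 0")
      case False
      have "0 \<le> c i * b (n - i)" for i
        using less[of "n - i"] cpos[of i] c0 False by (cases "i = 0") auto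
      then show ?thesis using bS[of n] False by (simp add: sum_nonneg)
    qed (use b0 in simp)
  qed
  have csum: "(\<Sum>i\<le>n. c i) \<le> 1" for n
    using sum_le_suminf[of c "{..n}"] sums cpos by (auto simp: sums_iff)
  have b1: "b n \<le> 1" for n
  proof (induction n rule: less_induct)
    case (less n)
    show ?case
    proof (cases "n = 0")
      case False
      have "c i * b (n - i) \<le> c i" for i
        using less[of "n - i"] cpos[of i] c0 False bnn by (cases "i = 0") (auto intro: mult_left_le)
      then have "(\<Sum>i\<le>n. c i * b (n - i)) \<le> (\<Sum>i\<le>n. c i)" by (simp add: sum_mono)
      then show ?thesis using bS[of n] False csum[of n] by simp
    qed (use b0 in simp)
  qed
  have step: "c 1 * b n \<le> b (Suc n)" for n
  proof -
    have "(\<Sum>i\<in>{1}. c i * b (Suc n - i)) \<le> (\<Sum>i\<le>Suc n. c i * b (Suc n - i))"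
      by (rule sum_mono2) (auto intro: mult_nonneg_nonneg cpos bnn)
    then show ?thesis using bS[of "Suc n"] by simp
  qed
  \<comment> \<open>A lower bound on one term carries over to the later ones at the cost of a factor
    \<open>c 1\<close> per step.\<close>
  have steps: "c 1 ^ i * b n \<le> b (n + i)" for n i
  proof (induction i)
    case (Suc i)
    have "c 1 * (c 1 ^ i * b n) \<le> c 1 * b (n + i)" using Suc c1 by (simp add: mult_left_mono)
    then show ?case using step[of "n + i"] by simp
  qed simp
  have c1le: "c 1 \<le> 1" using csum[of 1] c0 by simp
  define v where "v i = 1 - (\<Sum>l\<le>i. c l)" for i
  have vnn: "0 \<le> v i" for i using csum[of i] by (simp add: v_def)
  have sc: "summable c" using sums by (simp add: sums_iff)
  define W where "W = (\<Sum>l. c l * \<rho> ^ l)"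
  \<comment> \<open>\<open>v i\<close> is the sum of the \<open>c l\<close> with
    \<open>l > i\<close>, where \<open>\<rho> ^ i \<le> \<rho> ^ l\<close>; so
    \<open>v i * \<rho> ^ i\<close> is at most the full sum \<open>W\<close>.\<close>
  have vle: "v i \<le> W * (1/\<rho>) ^ i" for i
  proof -
    have "v i = (\<Sum>l. c (l + Suc i))"
      using suminf_split_initial_segment[OF sc, of "Suc i"] sums
      by (simp add: v_def sums_iff lessThan_Suc_atMost)
    moreover have "(\<Sum>l. c (l + Suc i)) * \<rho> ^ i \<le> (\<Sum>l. c (l + Suc i) * \<rho> ^ (l + Suc i))"
    proof -
      have s1: "summable (\<lambda>l. c (l + Suc i))" using sc summable_iff_shift by blast
      have s2: "summable (\<lambda>l. c (l + Suc i) * \<rho> ^ (l + Suc i))"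
        using summable_iff_shift[of "\<lambda>l. c l * \<rho> ^ l" "Suc i"] summ by simp
      have "(\<Sum>l. c (l + Suc i)) * \<rho> ^ i = (\<Sum>l. c (l + Suc i) * \<rho> ^ i)"
        by (rule suminf_mult2[OF s1])
      also have "\<dots> \<le> (\<Sum>l. c (l + Suc i) * \<rho> ^ (l + Suc i))"
        by (rule suminf_le[OF _ summable_mult2[OF s1] s2]) (use \<rho> cpos in \<open>intro mult_left_mono power_increasing; simp\<close>)
      finally show ?thesis .
    qed
    moreover have "(\<Sum>l. c (l + Suc i) * \<rho> ^ (l + Suc i)) \<le> W"
    proof -
      have "(\<Sum>l<Suc i. c l * \<rho> ^ l) \<ge> 0" using cpos \<rho> by (intro sum_nonneg) simp
      then show ?thesis using suminf_split_initial_segment[OF summ, of "Suc i"] by (simp add: W_def)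
    qed
    ultimately have "v i * \<rho> ^ i \<le> W" by simp
    then show ?thesis using \<rho> by (simp add: field_simps)
  qed
  have sv: "summable v"
  proof (rule summable_comparison_test)
    show "\<exists>N. \<forall>n\<ge>N. norm (v n) \<le> W * (1/\<rho>) ^ n" using vle vnn by auto
    show "summable (\<lambda>n. W * (1/\<rho>) ^ n)"
      using \<rho> by (intro summable_mult summable_geometric) (simp add: norm_divide)
  qed
  \<comment> \<open>Since \<open>v (Suc i) = v i - c (Suc i)\<close>, the step splits off the sum of
    the \<open>c (Suc i) * b (n - i)\<close>. By the renewal equation this is
    \<open>b (Suc n)\<close>, which cancels the new term because \<open>v 0 = 1\<close>.\<close>
  have conv: "(\<Sum>i\<le>n. v i * b (n - i)) = 1" for n
  proof (induction n)
    case 0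
    show ?case by (simp add: v_def c0 b0)
  next
    case (Suc n)
    have "(\<Sum>i\<le>Suc n. v i * b (Suc n - i)) = v 0 * b (Suc n) + (\<Sum>i\<le>n. v (Suc i) * b (n - i))"
      by (simp add: sum.atMost_Suc_shift del: sum.atMost_Suc)
    also have "(\<Sum>i\<le>n. v (Suc i) * b (n - i)) = (\<Sum>i\<le>n. v i * b (n - i)) - (\<Sum>i\<le>n. c (Suc i) * b (n - i))"
      by (simp add: v_def algebra_simps sum.distrib sum_subtractf flip: sum_subtractf)
    also have "(\<Sum>i\<le>n. c (Suc i) * b (n - i)) = b (Suc n)"
      using bS[of "Suc n"] by (simp add: sum.atMost_Suc_shift c0 del: sum.atMost_Suc)
    finally show ?case using Suc by (simp add: v_def c0)
  qed
  define V where "V = suminf v"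
  have V1: "V \<ge> 1"
    using sum_le_suminf[OF sv, of "{0}"] vnn by (simp add: V_def v_def c0)
  have "(0::real) < 1/2" by simp
  from suminf_exist_split[OF this sv] obtain L where "norm (\<Sum>i. v (i + L)) < 1/2" by blast
  then have L: "(\<Sum>i. v (i + L)) < 1/2" by simp
  have "c 1 ^ L / (2 * V) \<le> b n" for n
  proof -
    \<comment> \<open>Were all terms of the window below \<open>1 / (2 * V)\<close>, their share of
      the convolution would be at most 1/2, as the \<open>v i\<close> sum to \<open>V\<close>. The
      remaining share is below 1/2 by the choice of \<open>L\<close> and \<open>b \<le> 1\<close>,
      so the total could not be 1.\<close>
    have "\<exists>i\<le>n. i < L \<and> 1 / (2 * V) \<le> b (n - i)"
    proof (rule ccontr)
      assume "\<not> ?thesis"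
      then have neg: "b (n - i) < 1 / (2 * V)" if "i \<le> n" "i < L" for i using that by force
      have "1 = (\<Sum>i\<le>n. v i * b (n - i))" using conv by simp
      also have "\<dots> \<le> (\<Sum>i\<le>n. if i < L then v i * (1 / (2 * V)) else v i)"
      proof (rule sum_mono)
        fix i assume "i \<in> {..n}"
        then have "i < L \<Longrightarrow> b (n - i) \<le> 1 / (2 * V)" using neg[of i] by simp
        then show "v i * b (n - i) \<le> (if i < L then v i * (1 / (2 * V)) else v i)"
          using vnn[of i] b1[of "n - i"] mult_left_mono mult_left_le by (metis (full_types))
      qed
      \<comment> \<open>Running up to \<open>n + L\<close> adds only nonnegative terms and lets the
        sum be split at \<open>L\<close> even when \<open>n < L\<close>.\<close>
      also have "\<dots> \<le> (\<Sum>i\<in>{..<L} \<union> {L..n+L}. if i < L then v i * (1 / (2 * V)) else v i)"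
        using vnn V1 by (intro sum_mono2) auto
      also have "\<dots> = (\<Sum>i<L. v i * (1 / (2 * V))) + (\<Sum>i\<in>{L..n+L}. v i)"
        by (subst sum.union_disjoint) auto
      also have "(\<Sum>i\<in>{L..n+L}. v i) = (\<Sum>i\<le>n. v (i + L))"
        using sum.shift_bounds_cl_nat_ivl[of v 0 L n] by (simp add: atLeast0AtMost)
      also have "\<dots> \<le> (\<Sum>i. v (i + L))"
        using sv vnn by (intro sum_le_suminf) (auto simp: summable_iff_shift)
      also have "(\<Sum>i<L. v i * (1 / (2 * V))) = (\<Sum>i<L. v i) / (2 * V)"
        by (simp add: sum_divide_distrib)
      also have "(\<Sum>i<L. v i) \<le> V"
        unfolding V_def using sv vnn by (intro sum_le_suminf) auto
      finally show False using L V1 by (simp add: divide_right_mono)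
    qed
    then obtain i where i: "i \<le> n" "i < L" "1 / (2 * V) \<le> b (n - i)" by blast
    have "c 1 ^ L / (2 * V) \<le> c 1 ^ i * (1 / (2 * V))"
      using i c1 c1le V1 by (simp add: divide_right_mono power_decreasing)
    also have "\<dots> \<le> c 1 ^ i * b (n - i)" using i c1 by (intro mult_left_mono) auto
    also have "\<dots> \<le> b n" using steps[of i "n - i"] i by simp
    finally show ?thesis .
  qed
  moreover have "c 1 ^ L / (2 * V) > 0" using c1 V1 by simp
  ultimately show ?thesis using b1 by blast
qed

text \<open>Coefficientwise, the renewal equation together with \<open>b 0 = 1\<close> says (1 -
  \<gamma>) B = 1 for the generating function B of \<open>b\<close>. The Cauchy product makes this
  an identity of numbers, which also shows \<open>\<gamma> \<noteq> 1\<close>.\<close>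

lemma renewal_generating_function:
  fixes b c :: "nat \<Rightarrow> real"
  assumes bS: "\<And>n. n > 0 \<Longrightarrow> b n = (\<Sum>i\<le>n. c i * b (n - i))" and b0: "b 0 = 1" and c0: "c 0 = 0"
    and bnd: "\<And>n. \<bar>b n\<bar> \<le> 1" and t: "norm t < 1"
    and C: "(\<lambda>n. of_real (c n) * t ^ n) sums \<gamma>" and Cabs: "summable (\<lambda>n. norm (complex_of_real (c n) * t ^ n))"
  shows "(\<lambda>n. complex_of_real (b n) * t ^ n) sums (1 / (1 - \<gamma>)) \<and> \<gamma> \<noteq> 1"
proof -
  have Babs: "summable (\<lambda>n. norm (complex_of_real (b n) * t ^ n))"
  proof (rule summable_comparison_test)
    show "\<exists>N. \<forall>n\<ge>N. norm (norm (complex_of_real (b n) * t ^ n)) \<le> norm t ^ n"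
      using bnd by (auto simp: norm_mult norm_power intro!: mult_left_le_one_le)
    show "summable (\<lambda>n. norm t ^ n)" using t by (intro summable_geometric) simp
  qed
  define B where "B = (\<Sum>n. complex_of_real (b n) * t ^ n)"
  have B: "(\<lambda>n. complex_of_real (b n) * t ^ n) sums B"
    unfolding B_def using summable_norm_cancel[OF Babs] by (rule summable_sums)
  \<comment> \<open>The correction at index 0 is due to \<open>b 0 = 1\<close>, whereas the
    convolution there is 0.\<close>
  have term_eq: "(\<Sum>i\<le>n. (of_real (c i) * t ^ i) * (of_real (b (n - i)) * t ^ (n - i)))
     = of_real (b n) * t ^ n - (if n = 0 then 1 else 0)" for n
  proof -
    have "(\<Sum>i\<le>n. (of_real (c i) * t ^ i) * (of_real (b (n - i)) * t ^ (n - i)))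
        = (\<Sum>i\<le>n. of_real (c i * b (n - i)) * (t ^ i * t ^ (n - i)))"
      by (intro sum.cong refl) (simp add: mult_ac)
    also have "\<dots> = (\<Sum>i\<le>n. of_real (c i * b (n - i)) * t ^ n)"
      by (intro sum.cong refl) (simp flip: power_add)
    also have "\<dots> = of_real (\<Sum>i\<le>n. c i * b (n - i)) * t ^ n"
      by (simp add: sum_distrib_right)
    also have "(\<Sum>i\<le>n. c i * b (n - i)) = b n - (if n = 0 then 1 else 0)"
      using bS[of n] b0 c0 by auto
    finally show ?thesis by (cases "n = 0") auto
  qed
  have "(\<lambda>n. of_real (b n) * t ^ n - (if n = 0 then 1 else 0)) sums (\<gamma> * B)"
    using Cauchy_product_sums[OF Cabs Babs] C by (simp add: term_eq B_def sums_iff)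
  moreover have "(\<lambda>n. of_real (b n) * t ^ n - (if n = 0 then 1 else 0)) sums (B - 1)"
    using sums_diff[OF B sums_single[of 0 "\<lambda>_. 1"]] by simp
  ultimately have "\<gamma> * B = B - 1" by (rule sums_unique2)
  then have "(1 - \<gamma>) * B = 1" by (simp add: algebra_simps)
  moreover from this have "\<gamma> \<noteq> 1" by auto
  ultimately have "\<gamma> \<noteq> 1" "B = 1 / (1 - \<gamma>)" by (simp_all add: nonzero_eq_divide_eq mult.commute)
  then show ?thesis using B by simp
qed

section \<open>Kernels of the form 1 / (1 - u)\<close>

text \<open>With nonnegative coefficients the modulus of \<open>\<phi> t\<close> is at most the sum
  at \<open>\<rho>\<close>, hence below 1, and the denominator has no zeros. The kernel extends to
  radius \<open>sqrt \<rho>\<close>, because products \<open>z * cnj w\<close> then stay within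
  radius \<open>\<rho>\<close>.\<close>

lemma extends_to_larger_discI:
  fixes c :: "nat \<Rightarrow> real"
  assumes hol: "\<phi> holomorphic_on ball 0 \<rho>" and \<rho>: "\<rho> > 1"
    and sums: "\<And>t. norm t < \<rho> \<Longrightarrow> (\<lambda>l. of_real (c l) * t ^ l) sums \<phi> t"
    and cpos: "\<And>l. 0 \<le> c l" and summ: "summable (\<lambda>l. c l * \<rho> ^ l)" and less: "(\<Sum>l. c l * \<rho> ^ l) < 1"
    and k: "\<And>z w. z \<in> disc \<Longrightarrow> w \<in> disc \<Longrightarrow> k z w = A / (1 - \<phi> (z * cnj w))"
  shows "extends_to_larger_disc k"
proof -
  have ne: "\<phi> t \<noteq> 1" if t: "norm t < \<rho>" for t
  proof -
    have le: "norm (of_real (c l) * t ^ l) \<le> c l * \<rho> ^ l" for l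
      using cpos[of l] t by (auto simp: norm_mult norm_power intro!: mult_left_mono power_mono)
    have "norm (\<Sum>l. of_real (c l) * t ^ l) \<le> (\<Sum>l. c l * \<rho> ^ l)"
      by (rule norm_suminf_le[OF le summ])
    then show ?thesis using less sums[OF t] by (auto simp: sums_iff)
  qed
  \<comment> \<open>Real coefficients make \<open>\<phi>\<close> commute with conjugation, which
    turns analyticity in \<open>z\<close> into anti-analyticity in \<open>w\<close>.\<close>
  have cnj\<phi>: "cnj (\<phi> t) = \<phi> (cnj t)" if "norm t < \<rho>" for t
  proof (rule sums_unique2)
    show "(\<lambda>l. of_real (c l) * cnj t ^ l) sums cnj (\<phi> t)"
      using sums_cnj[THEN iffD2, OF sums[OF that]] by simp
    show "(\<lambda>l. of_real (c l) * cnj t ^ l) sums \<phi> (cnj t)" using sums[of "cnj t"] that by simp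
  qed
  define K where "K z w = A / (1 - \<phi> (z * cnj w))" for z w
  have in_ball: "norm (z * w) < \<rho>" if "norm z < sqrt \<rho>" "norm w < sqrt \<rho>" for z w :: complex
    using mult_strict_mono[OF that] \<rho> by (simp add: norm_mult)
  have hol1: "(\<lambda>z. B / (1 - \<phi> (z * w))) holomorphic_on ball 0 (sqrt \<rho>)" if "norm w < sqrt \<rho>" for w B
  proof -
    have "(\<phi> \<circ> (\<lambda>z. z * w)) holomorphic_on ball 0 (sqrt \<rho>)"
      by (rule holomorphic_on_compose_gen[OF _ hol]) (use in_ball that in \<open>auto intro!: holomorphic_intros\<close>)
    then have "(\<lambda>z. \<phi> (z * w)) holomorphic_on ball 0 (sqrt \<rho>)" by (simp add: o_def)
    then show ?thesis
    proof (intro holomorphic_intros)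
      fix z :: complex assume "z \<in> ball 0 (sqrt \<rho>)"
      then show "1 - \<phi> (z * w) \<noteq> 0" using ne[OF in_ball[of z w]] that by simp
    qed
  qed
  show ?thesis
    unfolding extends_to_larger_disc_def
  proof (intro exI[of _ "sqrt \<rho>"] exI[of _ K] conjI ballI)
    show "sqrt \<rho> > 1" using \<rho> by simp
    show "K z w = k z w" if "z \<in> disc" "w \<in> disc" for z w using k that by (simp add: K_def)
    show "(\<lambda>z. K z w) holomorphic_on ball 0 (sqrt \<rho>)" if "w \<in> ball 0 (sqrt \<rho>)" for w
      unfolding K_def using hol1[of "cnj w"] that by simp
    show "(\<lambda>w. cnj (K z w)) holomorphic_on ball 0 (sqrt \<rho>)" if z: "z \<in> ball 0 (sqrt \<rho>)" for z
    proof (rule holomorphic_transform[OF hol1[of "cnj z" "cnj A"]])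
      show "norm (cnj z) < sqrt \<rho>" using z by simp
      fix w :: complex assume "w \<in> ball 0 (sqrt \<rho>)"
      then have "norm (z * cnj w) < \<rho>" using in_ball[of z "cnj w"] z by simp
      then show "cnj A / (1 - \<phi> (w * cnj z)) = cnj (K z w)"
        by (simp add: K_def cnj\<phi> mult.commute)
    qed
  qed
qed

text \<open>Take 0 as base point in the necessity theorem. From \<open>q 0 = 0\<close> follows
  k(z,0) = k(0,z) = k(0,0), so the matrix there has the entries 1 - k(0,0) / k(z,w), which is k(0,0)
  q(z cnj w).\<close>

lemma (in rkhs_disc) complete_pick_coeffs:
  assumes irr: "irreducible_kernel k" and pick: "complete_pick H ip k" and R: "R > 1"
    and q_hol: "q holomorphic_on ball 0 R"
    and q_eq: "\<And>z w. z \<in> disc \<Longrightarrow> w \<in> disc \<Longrightarrow> 1 / k 0 0 - 1 / k z w = q (z * cnj w)"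
  shows "Im (k 0 0 * taylor0 q n) = 0 \<and> 0 \<le> Re (k 0 0 * taylor0 q n)"
proof (rule psd_power_series_coeffs_nonneg)
  have d0: "0 \<in> disc" by (simp add: disc_def)
  have nz: "k z w \<noteq> 0" if "z \<in> disc" "w \<in> disc" for z w
    using irr that by (auto simp: irreducible_kernel_def)
  show "(\<lambda>l. k 0 0 * taylor0 q l * t ^ l) sums (k 0 0 * q t)" if "norm t < 1" for t
    using sums_mult[OF taylor0_sums[OF q_hol, of t], of "k 0 0"] that R by (simp add: mult.assoc)
  fix N :: nat and lam :: "nat \<Rightarrow> complex"
  assume "\<And>j. j < N \<Longrightarrow> norm (lam j) < 1"
  then have lam: "\<And>j. j < N \<Longrightarrow> lam j \<in> disc" by (simp add: disc_def)
  have q0: "q 0 = 0" using q_eq[OF d0 d0] by simp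
  have kz: "k z 0 = k 0 0" "k 0 z = k 0 0" if "z \<in> disc" for z
    using q_eq[OF that d0] q_eq[OF d0 that] nz[OF that d0] nz[OF d0 that] nz[OF d0 d0] q0
    by (auto simp: field_simps)
  show "psd_on {..<N} (\<lambda>i j. k 0 0 * q (lam i * cnj (lam j)))"
  proof (rule psd_on_cong[OF McCullough_Quiggin_necessity[OF irr pick lam d0]])
    fix i j assume "i \<in> {..<N}" "j \<in> {..<N}"
    then have "lam i \<in> disc" "lam j \<in> disc" using lam by auto
    then show "k 0 0 * q (lam i * cnj (lam j)) = 1 - k (lam i) 0 * k 0 (lam j) / (k 0 0 * k (lam i) (lam j))"
      using nz[OF d0 d0] nz[of "lam i" "lam j"] by (simp add: kz field_simps flip: q_eq)
  qed
qed

theorem theorem1p10: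
  fixes H :: "(complex \<Rightarrow> complex) set"
    and ip :: "(complex \<Rightarrow> complex) \<Rightarrow> (complex \<Rightarrow> complex) \<Rightarrow> complex"
    and k :: "complex \<Rightarrow> complex \<Rightarrow> complex"
    and q :: "complex \<Rightarrow> complex"
    and R :: real
  assumes rkhs: "is_rkhs_disc H ip k"
    and analytic: "\<forall>f\<in>H. f holomorphic_on disc"
    and irred: "irreducible_kernel k"
    and pick: "complete_pick H ip k"
    and R: "R > 1"
    and q_hol: "q holomorphic_on ball 0 R"
    and q_eq: "\<forall>z\<in>disc. \<forall>w\<in>disc. 1 / k 0 0 - 1 / k z w = q (z * cnj w)"
    and q_deriv: "deriv q 0 \<noteq> 0"
    and no_ext: "\<not> extends_to_larger_disc k"
  shows "H = hardy2 \<and>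
         (\<exists>c C. 0 < c \<and> 0 < C \<and>
            (\<forall>f\<in>H. c * hardy2_norm f \<le> hnorm ip f \<and> hnorm ip f \<le> C * hardy2_norm f))"
proof -
  interpret rkhs_disc H ip k by unfold_locales (rule rkhs)
  have d0: "0 \<in> disc" by (simp add: disc_def)
  have nz: "k z w \<noteq> 0" if "z \<in> disc" "w \<in> disc" for z w
    using irred that by (auto simp: irreducible_kernel_def)
  define A where "A = (hnorm ip (kfun k 0))\<^sup>2"
  have kA: "k 0 0 = of_real A" using kernel_diag[OF d0] by (simp add: A_def)
  have A: "A > 0" using nz[OF d0 d0] kA by (auto simp: A_def)
  define \<phi> where "\<phi> t = of_real A * q t" for t
  have \<phi>_hol: "\<phi> holomorphic_on ball 0 R"
    unfolding \<phi>_def by (intro holomorphic_intros q_hol)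
  define c where "c l = Re (of_real A * taylor0 q l)" for l
  have "Im (of_real A * taylor0 q l) = 0 \<and> 0 \<le> c l" for l
    using complete_pick_coeffs[OF irred pick R q_hol, of l] q_eq by (simp add: c_def kA)
  then have cA: "of_real A * taylor0 q l = of_real (c l)" and cpos: "0 \<le> c l" for l
    by (auto simp: c_def complex_eq_iff)
  have \<phi>_sums: "(\<lambda>l. of_real (c l) * t ^ l) sums \<phi> t" if "norm t < R" for t
    using sums_mult[OF taylor0_sums[OF q_hol that], of "of_real A"]
    by (simp add: \<phi>_def mult.assoc flip: cA)
  have q0: "q 0 = 0" using q_eq d0 by force
  have c0: "c 0 = 0" by (simp add: c_def taylor0_def q0)
  have "c 1 \<noteq> 0" using cA[of 1] q_deriv A by (auto simp: taylor0_def)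
  then have c1: "c 1 > 0" using cpos[of 1] by simp
  have kphi: "1 / k z w = (1 - \<phi> (z * cnj w)) / of_real A" if "z \<in> disc" "w \<in> disc" for z w
  proof -
    have "1 / of_real A - 1 / k z w = q (z * cnj w)" using q_eq that by (simp add: kA)
    then have "1 / k z w = 1 / of_real A - q (z * cnj w)" by (simp add: algebra_simps)
    then show ?thesis using A by (simp add: \<phi>_def diff_divide_distrib)
  qed
  have k\<phi>: "k z w = of_real A / (1 - \<phi> (z * cnj w))" if "z \<in> disc" "w \<in> disc" for z w
    using arg_cong[OF kphi[OF that], of inverse] by (simp add: inverse_eq_divide)
  define g where "g x = Re (\<phi> (of_real x))" for x
  have g_sums: "(\<lambda>l. c l * x ^ l) sums g x" if "0 \<le> x" "x < R" for x
    using sums_Re[OF \<phi>_sums[of "of_real x"]] that by (simp add: g_def flip: of_real_power of_real_mult)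
  have \<phi>g: "\<phi> (of_real x) = of_real (g x)" if "0 \<le> x" "x < R" for x
    using \<phi>_sums[of "of_real x"] sums_of_real[OF g_sums[OF that], where 'a = complex] that sums_unique2
    by fastforce
  have g_cont: "continuous_on {0..y} g" if "y < R" for y
    unfolding g_def
  proof (intro continuous_intros continuous_on_compose2[OF holomorphic_on_imp_continuous_on[OF \<phi>_hol]])
    show "complex_of_real ` {0..y} \<subseteq> ball 0 R" using that by auto
  qed
  \<comment> \<open>At the point \<open>sqrt x\<close> of the disc, \<open>g x = 1\<close> would
    force \<open>1 / k z z = 0\<close>, although \<open>k z z\<close> is a nonzero number.\<close>
  have g1: "g x \<noteq> 1" if "0 \<le> x" "x < 1" for x
  proof
    assume "g x = 1"
    define z where "z = complex_of_real (sqrt x)"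
    have z: "z \<in> disc" using that by (simp add: z_def disc_def)
    have "z * cnj z = of_real x" using that by (simp add: z_def flip: of_real_mult)
    then have "1 / k z z = 0" using kphi[OF z z] \<phi>g[of x] \<open>g x = 1\<close> that R by simp
    then show False using nz[OF z z] by simp
  qed
  have g0: "g 0 = 0" by (simp add: g_def \<phi>_def q0)
  have le1: "g 1 \<le> 1"
  proof (rule ccontr)
    assume "\<not> g 1 \<le> 1"
    then obtain x where "0 \<le> x" "x \<le> 1" "g x = 1"
      using IVT'[of g 0 1 1] g0 g_cont[OF R] by auto
    then show False using g1[of x] \<open>\<not> g 1 \<le> 1\<close> by (cases "x = 1") auto
  qed
  have "g 1 = 1"
  proof (rule ccontr)
    assume "g 1 \<noteq> 1"
    then have l1: "g 1 < 1" using le1 by simp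
    define s where "s = (1 + R) / 2"
    have s: "1 < s" "s < R" using R by (auto simp: s_def)
    \<comment> \<open>Either \<open>s\<close> itself serves, or \<open>g s \<ge> 1\<close> and
      \<open>g\<close> takes on [1, s] the value halfway between \<open>g 1\<close> and 1, at a
      point that cannot be 1.\<close>
    obtain \<rho> where \<rho>: "1 < \<rho>" "\<rho> < R" "g \<rho> < 1"
    proof (cases "g s < 1")
      case False
      have "continuous_on {1..s} g" by (rule continuous_on_subset[OF g_cont[OF s(2)]]) auto
      then obtain x where x: "1 \<le> x" "x \<le> s" "g x = (g 1 + 1) / 2"
        using IVT'[of g 1 "(g 1 + 1) / 2" s] l1 False s by auto
      then have "x \<noteq> 1" using l1 by auto
      then show ?thesis using that[of x] x s l1 by auto
    qed (use s that in blast)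
    have "extends_to_larger_disc k"
    proof (rule extends_to_larger_discI[where \<phi> = \<phi> and c = c and A = "of_real A", OF _ \<rho>(1) _ cpos _ _ k\<phi>])
      show "\<phi> holomorphic_on ball 0 \<rho>" using \<phi>_hol by (rule holomorphic_on_subset) (use \<rho> in auto)
      show "(\<lambda>l. of_real (c l) * t ^ l) sums \<phi> t" if "norm t < \<rho>" for t using \<phi>_sums that \<rho> by simp
      show "summable (\<lambda>l. c l * \<rho> ^ l)" "(\<Sum>l. c l * \<rho> ^ l) < 1"
        using g_sums[of \<rho>] \<rho> by (auto simp: sums_iff)
    qed
    then show False using no_ext by simp
  qed
  then have c_sums: "c sums 1" using g_sums[of 1] R by simp
  \<comment> \<open>The formal inverse of 1 - c, available since \<open>c 0 = 0\<close>; comparing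
    coefficients in the product yields the renewal equation. Convergence is dealt with afterwards,
    once \<open>renewal_bounds\<close> has bounded \<open>b\<close>.\<close>
  define b where "b = fps_nth (inverse (1 - Abs_fps c))"
  have fps: "(1 - Abs_fps c) * inverse (1 - Abs_fps c) = 1"
    by (rule inverse_mult_eq_1') (simp add: c0)
  have bn: "b n - (\<Sum>i\<le>n. c i * b (n - i)) = (if n = 0 then 1 else 0)" for n
    using arg_cong[OF fps, of "\<lambda>F. fps_nth F n"]
    by (simp add: left_diff_distrib fps_mult_nth b_def atLeast0AtMost)
  have b0: "b 0 = 1" using bn[of 0] c0 by simp
  have bS: "b n = (\<Sum>i\<le>n. c i * b (n - i))" if "n > 0" for n using bn[of n] that by simp
  \<comment> \<open>A radius strictly between 1 and \<open>R\<close> witnesses the geometric decay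
    of \<open>c\<close>.\<close>
  define s where "s = (1 + R) / 2"
  have s: "1 < s" "s < R" using R by (auto simp: s_def)
  have "summable (\<lambda>n. c n * s ^ n)" using g_sums[of s] s by (auto simp: sums_iff)
  from renewal_bounds[OF c0 cpos c1 c_sums s(1) this b0 bS]
  obtain m where m: "m > 0" and b: "\<And>n. m \<le> b n" "\<And>n. b n \<le> 1" by blast
  have ksums: "(\<lambda>l. of_real (A * b l) * (z * cnj w) ^ l) sums k z w" if "z \<in> disc" "w \<in> disc" for z w
  proof -
    define t where "t = z * cnj w"
    have t: "norm t < 1"
      using that mult_strict_mono[of "norm z" 1 "norm w" 1] by (simp add: t_def disc_def norm_mult)
    have "summable (\<lambda>n. complex_of_real (c n) * 1 ^ n)"
      using \<phi>_sums[of 1] R by (simp add: sums_iff)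
    then have "summable (\<lambda>n. norm (complex_of_real (c n) * t ^ n))"
      by (rule powser_insidea) (use t in simp)
    moreover have "\<bar>b n\<bar> \<le> 1" for n using b[of n] m by simp
    ultimately have "(\<lambda>n. complex_of_real (b n) * t ^ n) sums (1 / (1 - \<phi> t))"
      using renewal_generating_function[OF bS b0 c0 _ t \<phi>_sums] t R by simp
    from sums_mult[OF this, of "of_real A"] show ?thesis
      using k\<phi>[OF that] by (simp add: t_def mult.assoc)
  qed
  have Am: "0 < A * m" "A * m \<le> A * b n" "A * b n \<le> A" for n using A m b[of n] by auto
  have hol: "f holomorphic_on disc" if "f \<in> H" for f using analytic that by blast
  have hardy: "H = hardy2" by (rule diagonal_kernel_hardy2(1)[OF hol ksums Am])
  \<comment> \<open>The weights \<open>1 / (A * b n)\<close> lie between \<open>1 / A\<close> and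
    \<open>1 / (A * m)\<close>; the constants are the square roots of these bounds.\<close>
  have bounds: "1 / sqrt A * hardy2_norm f \<le> hnorm ip f \<and> hnorm ip f \<le> 1 / sqrt (A * m) * hardy2_norm f"
    if f: "f \<in> H" for f
  proof -
    define t where "t n = (cmod (taylor0 f n))\<^sup>2" for n
    have "f \<in> hardy2" using f hardy by simp
    then have st: "summable t" by (simp add: hardy2_def t_def[abs_def])
    have hs: "(\<lambda>n. t n / (A * b n)) sums (hnorm ip f)\<^sup>2"
      unfolding t_def by (rule diagonal_kernel_hardy2(2)[OF hol ksums Am f])
    have hn: "hnorm ip f = sqrt (\<Sum>n. t n / (A * b n))"
      using hs hnorm_nonneg[OF f] by (simp add: sums_iff)
    have t0: "0 \<le> t n" for n by (simp add: t_def)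
    have bp: "b n > 0" for n using b(1)[of n] m by simp
    have "(\<Sum>n. t n / A) \<le> (\<Sum>n. t n / (A * b n))"
      using A m b bp t0 st hs
      by (intro suminf_le summable_divide) (auto simp: sums_iff intro!: divide_left_mono)
    then have "suminf t / A \<le> (\<Sum>n. t n / (A * b n))" by (simp add: suminf_divide[OF st])
    moreover have "(\<Sum>n. t n / (A * b n)) \<le> (\<Sum>n. t n / (A * m))"
      using A m b bp t0 st hs
      by (intro suminf_le summable_divide) (auto simp: sums_iff intro!: divide_left_mono)
    then have "(\<Sum>n. t n / (A * b n)) \<le> suminf t / (A * m)" by (simp add: suminf_divide[OF st])
    ultimately show ?thesis
      unfolding hn hardy2_norm_def t_def[symmetric]
      by (simp flip: real_sqrt_divide)
  qed
  have "0 < 1 / sqrt A" "0 < 1 / sqrt (A * m)" using A m by simp_all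
  then show ?thesis using hardy bounds by blast
qed

end
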